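(* Let $H$ be a complex Hilbert space and let $\phi:B_s(H)\to B_s(H)$ be a bijective transformation (linearity is not assumed) with the property that \[ d_v(\phi(A),\phi(B))=d_v(A,B) \qquad (A,B\in B_s(H)). \] Then there exist an either unitary or antiunitary operator $U$ on $H$, a fixed operator $X\in B_s(H)$, and a functional $f:B_s(H)\to\mathbb R$ (not linear in general) such that $\phi$ is either of the form \[ \phi(A)=UAU^*+X+f(A)I \qquad (A\in B_s(H)) \] or of the form \[ \phi(A)=-UAU^*+X+f(A)I \qquad (A\in B_s(H)). \]
   Context: $B_s(H)$ denotes the real vector space of all self-adjoint bounded linear operators on the complex Hilbert space $H$, and $I$ is the identity operator. For $A\in B_s(H)$ and a unit vector $\varphi\in H$, the variance of $A$ in the state $\varphi$ is $var(A,\varphi)=\langle A^2\varphi,\varphi\rangle-\langle A\varphi,\varphi\rangle^2$, and the maximal deviation of $A$ is $\|A\|_v=\sup_{\|\varphi\|=1} var(A,\varphi)^{1/2}$. The semi-metric $d_v$ on $B_s(H)$ is $d_v(A,B)=\|A-B\|_v=\sup_{\|\varphi\|=1}var(A-B,\varphi)^{1/2}$. An antiunitary operator is a norm preserving conjugate-linear bijection $U$ of $H$; for unitary or antiunitary $U$ one has $U^*=U^{-1}$. *)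

theory Defs
  imports "HOL-Analysis.Analysis"
begin

text \<open>
  A complex Hilbert space is a complete real inner product space with a compatible complex scalar
  multiplication and a complex inner product whose real part is the given real one. Positive
  definiteness and \<open>norm x = sqrt (Re (cinner x x))\<close> are inherited from \<^class>\<open>real_inner\<close>.
  The complex inner product is linear in its first argument. No restriction is put on the
  dimension; in particular the zero space is allowed.
\<close>

class complex_hilbert_space = real_inner + complete_space +
  fixes scaleC :: "complex \<Rightarrow> 'a \<Rightarrow> 'a"  (infixr "*\<^sub>C" 75)
    and cinner :: "'a \<Rightarrow> 'a \<Rightarrow> complex"
  assumes scaleC_add_right: "c *\<^sub>C (x + y) = c *\<^sub>C x + c *\<^sub>C y"
    and scaleC_add_left: "(c + d) *\<^sub>C x = c *\<^sub>C x + d *\<^sub>C x"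
    and scaleC_scaleC: "c *\<^sub>C (d *\<^sub>C x) = (c * d) *\<^sub>C x"
    and scaleR_scaleC: "r *\<^sub>R x = complex_of_real r *\<^sub>C x"
    and cinner_commute: "cinner x y = cnj (cinner y x)"
    and cinner_add_left: "cinner (x + y) z = cinner x z + cinner y z"
    and cinner_scaleC_left: "cinner (c *\<^sub>C x) y = c * cinner x y"
    and inner_eq_Re_cinner: "inner x y = Re (cinner x y)"

instantiation complex :: complex_hilbert_space
begin
definition scaleC_complex :: "complex \<Rightarrow> complex \<Rightarrow> complex"
  where "scaleC_complex c x = c * x"
definition cinner_complex :: "complex \<Rightarrow> complex \<Rightarrow> complex"
  where "cinner_complex x y = x * cnj y"
instance
  by standard
    (simp_all add: scaleC_complex_def cinner_complex_def inner_complex_def algebra_simps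
      scaleR_conv_of_real)
end

text \<open>
  Bounded operators, whether complex-linear or conjugate-linear, are elements of the library type
  of bounded real-linear maps; behaviour with respect to complex scalars is a separate predicate.
\<close>

definition clinear_op :: "('a::complex_hilbert_space \<Rightarrow>\<^sub>L 'a) \<Rightarrow> bool"
  where "clinear_op T \<longleftrightarrow> (\<forall>c x. T (c *\<^sub>C x) = c *\<^sub>C T x)"

definition antilinear_op :: "('a::complex_hilbert_space \<Rightarrow>\<^sub>L 'a) \<Rightarrow> bool"
  where "antilinear_op T \<longleftrightarrow> (\<forall>c x. T (c *\<^sub>C x) = cnj c *\<^sub>C T x)"

text \<open>
  The adjoint of a conjugate-linear \<open>T\<close> is given by
  \<open>cinner (T x) y = cnj (cinner x (T\<^sup>* y))\<close>. It is only used for (conjugate-)linear \<open>T\<close>.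
\<close>

definition is_adjoint_op ::
    "('a::complex_hilbert_space \<Rightarrow>\<^sub>L 'a) \<Rightarrow> ('a \<Rightarrow>\<^sub>L 'a) \<Rightarrow> bool"
  where "is_adjoint_op T V \<longleftrightarrow>
    (if clinear_op T then \<forall>x y. cinner (T x) y = cinner x (V y)
     else \<forall>x y. cinner (T x) y = cnj (cinner x (V y)))"

definition adjoint_op :: "('a::complex_hilbert_space \<Rightarrow>\<^sub>L 'a) \<Rightarrow> ('a \<Rightarrow>\<^sub>L 'a)"
  where "adjoint_op T = (THE V. is_adjoint_op T V)"

definition Bs :: "('a::complex_hilbert_space \<Rightarrow>\<^sub>L 'a) set"
  where "Bs = {A. clinear_op A \<and> (\<forall>x y. cinner (A x) y = cinner x (A y))}"

definition unitary_op :: "('a::complex_hilbert_space \<Rightarrow>\<^sub>L 'a) \<Rightarrow> bool"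
  where "unitary_op U \<longleftrightarrow>
    clinear_op U \<and> bij (blinfun_apply U) \<and> (\<forall>x. norm (U x) = norm x)"

definition antiunitary_op :: "('a::complex_hilbert_space \<Rightarrow>\<^sub>L 'a) \<Rightarrow> bool"
  where "antiunitary_op U \<longleftrightarrow>
    antilinear_op U \<and> bij (blinfun_apply U) \<and> (\<forall>x. norm (U x) = norm x)"

text \<open>
  For self-adjoint \<open>A\<close> the inner products below are real, so taking real parts loses nothing.
\<close>

definition variance_op :: "('a::complex_hilbert_space \<Rightarrow>\<^sub>L 'a) \<Rightarrow> 'a \<Rightarrow> real"
  where "variance_op A \<phi> = Re (cinner (A (A \<phi>)) \<phi>) - (Re (cinner (A \<phi>) \<phi>))\<^sup>2"

definition max_deviation :: "('a::complex_hilbert_space \<Rightarrow>\<^sub>L 'a) \<Rightarrow> real"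
  where "max_deviation A = (SUP \<phi>\<in>{\<phi>. norm \<phi> = 1}. sqrt (variance_op A \<phi>))"

definition d_v :: "('a::complex_hilbert_space \<Rightarrow>\<^sub>L 'a) \<Rightarrow> ('a \<Rightarrow>\<^sub>L 'a) \<Rightarrow> real"
  where "d_v A B = max_deviation (A - B)"

text \<open>The supremum is that of a set of nonnegative reals bounded above.\<close>

lemma variance_op_bounds:
  assumes "A \<in> Bs" "norm \<phi> = 1"
  shows "0 \<le> variance_op A \<phi>" "variance_op A \<phi> \<le> (norm A)\<^sup>2"
proof -
  have *: "variance_op A \<phi> = (norm (A \<phi>))\<^sup>2 - (inner (A \<phi>) \<phi>)\<^sup>2"
    using assms(1)
    by (simp add: variance_op_def Bs_def power2_norm_eq_inner flip: inner_eq_Re_cinner)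
       (metis inner_eq_Re_cinner)
  have "\<bar>inner (A \<phi>) \<phi>\<bar> \<le> norm (A \<phi>)"
    using Cauchy_Schwarz_ineq2[of "A \<phi>" \<phi>] assms(2) by simp
  then show "0 \<le> variance_op A \<phi>"
    using * abs_le_square_iff by fastforce
  have "norm (A \<phi>) \<le> norm A"
    using norm_blinfun[of A \<phi>] assms(2) by simp
  then have "(norm (A \<phi>))\<^sup>2 \<le> (norm A)\<^sup>2"
    by (simp add: power_mono)
  then show "variance_op A \<phi> \<le> (norm A)\<^sup>2"
    using * by (smt (verit) zero_le_power2)
qed

lemma bdd_above_variance_op:
  assumes "A \<in> Bs"
  shows "bdd_above ((\<lambda>\<phi>. sqrt (variance_op A \<phi>)) ` {\<phi>. norm \<phi> = 1})"
  using variance_op_bounds(2)[OF assms]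
  by (auto intro!: bdd_aboveI[of _ "norm A"] real_le_lsqrt)

lemma adjoint_op_eqI:
  assumes "is_adjoint_op T V"
  shows "adjoint_op T = V"
  unfolding adjoint_op_def
proof (rule the_equality)
  fix W assume W: "is_adjoint_op T W"
  have c: "cinner x (W y) = cinner x (V y)" for x y
    using W assms unfolding is_adjoint_op_def by (metis complex_cnj_cnj)
  have "inner x (W y) = inner x (V y)" for x y
    by (simp add: inner_eq_Re_cinner c)
  then show "W = V"
    by (intro blinfun_eqI) (metis vector_eq_rdot inner_commute)
qed (fact assms)

text \<open>
  Norm preserving bijections that are linear or conjugate-linear satisfy \<open>U\<^sup>* = U\<^sup>-\<^sup>1\<close>; the linear
  ones are therefore unitary in the usual sense.
\<close>

lemma isometry_inner:
  assumes "\<And>x. norm (blinfun_apply U x) = norm x"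
  shows "inner (blinfun_apply U x) (U y) = inner x y"
  unfolding dot_norm by (simp add: assms flip: blinfun.add_right)

lemma Im_cinner: "Im (cinner x y) = - inner (\<i> *\<^sub>C x) y"
  by (simp add: inner_eq_Re_cinner cinner_scaleC_left)

lemma isometry_adjoint:
  assumes U: "unitary_op U \<or> antiunitary_op U"
  obtains V where "is_adjoint_op U V" "U o\<^sub>L V = id_blinfun" "V o\<^sub>L U = id_blinfun"
proof -
  have bij: "bij (blinfun_apply U)" and n: "\<And>x. norm (U x) = norm x"
    using U by (auto simp: unitary_op_def antiunitary_op_def)
  define g where "g = inv (blinfun_apply U)"
  have Ug: "U (g x) = x" and gU: "g (U x) = x" for x
    using bij by (auto simp: g_def bij_is_inj bij_is_surj surj_f_inv_f)
  have "bounded_linear g"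
  proof (rule bounded_linear_intro[where K = 1])
    show "g (x + y) = g x + g y" for x y by (metis Ug gU blinfun.add_right)
    show "g (r *\<^sub>R x) = r *\<^sub>R g x" for r x by (metis Ug gU blinfun.scaleR_right)
    show "norm (g x) \<le> norm x * 1" for x by (metis Ug n mult.right_neutral order_refl)
  qed
  then have V: "blinfun_apply (Blinfun g) = g" by (rule bounded_linear_Blinfun_apply)
  have inn: "inner (U x) (U y) = inner x y" for x y
    using n by (rule isometry_inner)
  have "is_adjoint_op U (Blinfun g)"
  proof (cases "clinear_op U")
    case True
    have "cinner (U x) (U y) = cinner x y" for x y
      using True inn by (intro complex_eqI)
        (simp_all add: Im_cinner clinear_op_def flip: inner_eq_Re_cinner, metis inn)
    then show ?thesis using True by (simp add: is_adjoint_op_def V) (metis Ug)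
  next
    case False
    then have a: "antilinear_op U" using U by (auto simp: unitary_op_def antiunitary_op_def)
    have "inner (\<i> *\<^sub>C U x) (U y) = - inner (\<i> *\<^sub>C x) y" for x y
    proof -
      have "U (\<i> *\<^sub>C x) = (- \<i>) *\<^sub>C U x" using a by (simp add: antilinear_op_def)
      then have "inner ((- \<i>) *\<^sub>C U x) (U y) = inner (\<i> *\<^sub>C x) y" by (metis inn)
      then show ?thesis by (simp add: inner_eq_Re_cinner cinner_scaleC_left)
    qed
    then have "cinner (U x) (U y) = cnj (cinner x y)" for x y
      using inn by (intro complex_eqI) (simp_all add: Im_cinner flip: inner_eq_Re_cinner)
    then show ?thesis using False by (simp add: is_adjoint_op_def V) (metis Ug)
  qed
  moreover have "U o\<^sub>L Blinfun g = id_blinfun" "Blinfun g o\<^sub>L U = id_blinfun"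
    by (auto intro!: blinfun_eqI simp: V Ug gU)
  ultimately show ?thesis using that by blast
qed

lemma adjoint_op_inverse:
  assumes "unitary_op U \<or> antiunitary_op U"
  shows "U o\<^sub>L adjoint_op U = id_blinfun" "adjoint_op U o\<^sub>L U = id_blinfun"
  using isometry_adjoint[OF assms] adjoint_op_eqI by metis+

lemma unitary_op_iff:
  "unitary_op U \<longleftrightarrow> clinear_op U \<and>
    (\<exists>V. is_adjoint_op U V \<and> U o\<^sub>L V = id_blinfun \<and> V o\<^sub>L U = id_blinfun)"
    (is "?l \<longleftrightarrow> ?r")
proof
  assume ?l
  then show ?r using isometry_adjoint[of U] by (metis unitary_op_def)
next
  assume ?r
  then obtain V where c: "clinear_op U" and "is_adjoint_op U V"
    and *: "U o\<^sub>L V = id_blinfun" "V o\<^sub>L U = id_blinfun"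
    by blast
  then have adj: "cinner (U x) y = cinner x (V y)" for x y
    by (simp add: is_adjoint_op_def)
  have UV: "U (V x) = x" and VU: "V (U x) = x" for x
    using * by (metis blinfun_apply_blinfun_compose blinfun_apply_id_blinfun id_apply)+
  have "bij (blinfun_apply U)" by (rule o_bij[of V]) (auto simp: UV VU)
  moreover have "norm (U x) = norm x" for x
    by (simp add: norm_eq_sqrt_inner inner_eq_Re_cinner adj VU)
  ultimately show ?l using c by (simp add: unitary_op_def)
qed

end

theory Submission
  imports Defs
begin

text \<open>
  Half the diameter of the numerical range equals the maximal deviation, so \<open>d\<^sub>v\<close> is the
  quotient metric modulo scalars, and a Mazur--Ulam argument makes \<open>\<phi>\<close>, after translation and
  up to scalars, a surjective real-linear isometry. It permutes the extreme points of the unit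
  ball, which are the nontrivial projections modulo scalars. Among them, those of rank or corank
  one are singled out metrically, and the images of all rank-one projections carry a common sign.
  With the positive sign, for a fixed unit vector \<open>e\<close> the images of the operators
  \<open>\<langle>\<cdot>, e\<rangle>x + \<langle>\<cdot>, x\<rangle>e\<close> with \<open>x \<bottom> e\<close> give a real-linear isometry of \<open>e\<^sup>\<bottom>\<close> that maps \<open>\<i>x\<close> to
  \<open>\<plusminus>\<i>\<close> times the image of \<open>x\<close> with a constant sign. It extends to the required (anti)unitary \<open>U\<close>,
  and comparison with large rank-two perturbations shows that \<open>A \<mapsto> UAU\<^sup>*\<close> agrees with the
  isometry on all operators and not only on those of finite rank.
\<close>

subsection \<open>Complex inner products and rank-one operators\<close>

text \<open>Variance is quadratic in the operator, so its definition does not show that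
  \<open>max_deviation\<close> is a seminorm. The basic step is to rewrite it as the supremum of
  \<open>inner (A x) y\<close> over orthonormal pairs, which is linear in \<open>A\<close>; rotating
  the pair by 45 degrees then gives the description by the numerical range. The null space consists
  of the real scalars, so identities come out modulo \<open>\<simeq>\<close> only, and this is the
  origin of the functional in the conclusion. To get a map that is linear on the nose, values are
  replaced by representatives whose form vanishes at \<open>e0\<close>. Small dimensions need care.
  Without an orthonormal pair every self-adjoint operator is scalar. In dimension two the negative
  of a rank-one projection is again a rank-one projection modulo scalars, so there the sign can
  always be taken positive. In infinite dimension the finite-rank operators are not norm dense and
  no weak continuity of the isometry is known, so its values on rank-one operators do not extend by
  a limit. This forces the comparison with perturbations at the end.\<close>

lemma scaleC_one [simp]: "1 *\<^sub>C x = (x::'a::complex_hilbert_space)"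
  using scaleR_scaleC[of 1 x] by simp

lemma scaleC_zero_left [simp]: "0 *\<^sub>C x = (0::'a::complex_hilbert_space)"
  using scaleR_scaleC[of 0 x] by simp

lemma scaleC_zero_right [simp]: "c *\<^sub>C 0 = (0::'a::complex_hilbert_space)"
  using scaleC_add_right[of c 0 0] by simp

lemma scaleC_minus_right [simp]: "c *\<^sub>C (- x) = - (c *\<^sub>C (x::'a::complex_hilbert_space))"
  using scaleC_add_right[of c x "- x"] by (simp add: eq_neg_iff_add_eq_0 add.commute)

lemma scaleC_minus_left [simp]: "(- c) *\<^sub>C x = - (c *\<^sub>C (x::'a::complex_hilbert_space))"
  using scaleC_add_left[of c "- c" x] by (simp add: eq_neg_iff_add_eq_0 add.commute)

lemma scaleC_diff_right: "c *\<^sub>C (x - y) = c *\<^sub>C x - c *\<^sub>C (y::'a::complex_hilbert_space)"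
  using scaleC_add_right[of c x "- y"] by simp

lemma scaleC_scaleR: "c *\<^sub>C (r *\<^sub>R x) = r *\<^sub>R (c *\<^sub>C (x::'a::complex_hilbert_space))"
  by (simp add: scaleR_scaleC scaleC_scaleC mult.commute)

lemma cinner_add_right: "cinner z (x + y) = cinner z x + cinner z (y::'a::complex_hilbert_space)"
  by (metis cinner_commute cinner_add_left complex_cnj_add)

lemma cinner_scaleC_right: "cinner x (c *\<^sub>C y) = cnj c * cinner x (y::'a::complex_hilbert_space)"
  by (metis cinner_commute cinner_scaleC_left complex_cnj_mult)

lemma cinner_scaleR_left: "cinner (r *\<^sub>R x) y = of_real r * cinner x (y::'a::complex_hilbert_space)"
  by (simp add: scaleR_scaleC cinner_scaleC_left)

lemma cinner_scaleR_right: "cinner x (r *\<^sub>R y) = of_real r * cinner x (y::'a::complex_hilbert_space)"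
  by (simp add: scaleR_scaleC cinner_scaleC_right)

lemma cinner_zero_left [simp]: "cinner 0 (x::'a::complex_hilbert_space) = 0"
  using cinner_scaleR_left[of 0 x x] by simp

lemma cinner_zero_right [simp]: "cinner (x::'a::complex_hilbert_space) 0 = 0"
  using cinner_scaleR_right[of x 0 x] by simp

lemma cinner_minus_left [simp]: "cinner (- x) y = - cinner x (y::'a::complex_hilbert_space)"
  using cinner_scaleR_left[of "-1" x y] by simp

lemma cinner_minus_right [simp]: "cinner x (- y) = - cinner x (y::'a::complex_hilbert_space)"
  using cinner_scaleR_right[of x "-1" y] by simp

lemma cinner_diff_left: "cinner (x - y) z = cinner x z - cinner y (z::'a::complex_hilbert_space)"
  using cinner_add_left[of x "- y" z] by simp

lemma cinner_diff_right: "cinner z (x - y) = cinner z x - cinner z (y::'a::complex_hilbert_space)"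
  using cinner_add_right[of z x "- y"] by simp

lemmas cinner_simps = cinner_add_left cinner_add_right cinner_diff_left cinner_diff_right
  cinner_scaleC_left cinner_scaleC_right cinner_scaleR_left cinner_scaleR_right

lemma cinner_self: "cinner x x = of_real ((norm (x::'a::complex_hilbert_space))\<^sup>2)"
proof (rule complex_eqI)
  show "Re (cinner x x) = Re (of_real ((norm x)\<^sup>2))"
    by (simp add: power2_norm_eq_inner inner_eq_Re_cinner)
  show "Im (cinner x x) = Im (of_real ((norm x)\<^sup>2))"
    using arg_cong[OF cinner_commute[of x x], of Im] by simp
qed

lemma cinner_eq_0_commute: "cinner x y = 0 \<Longrightarrow> cinner y (x::'a::complex_hilbert_space) = 0"
  by (metis cinner_commute complex_cnj_zero)

lemma cinner_0_inner: "cinner x y = 0 \<Longrightarrow> inner x (y::'a::complex_hilbert_space) = 0"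
  by (simp add: inner_eq_Re_cinner)

lemma mult_cnj_left: "c * (cnj c * z) = (of_real (cmod c))\<^sup>2 * z"
  using complex_norm_square[of c] by (simp flip: mult.assoc)

lemma norm_scaleC [simp]: "norm (c *\<^sub>C x) = cmod c * norm (x::'a::complex_hilbert_space)"
proof -
  have "complex_of_real ((norm (c *\<^sub>C x))\<^sup>2) = of_real ((cmod c * norm x)\<^sup>2)"
    unfolding cinner_self[of "c *\<^sub>C x", symmetric] cinner_scaleC_left cinner_scaleC_right
    by (simp add: cinner_self[of x] power_mult_distrib mult_cnj_left mult.left_commute[of "cnj c"])
  then have "(norm (c *\<^sub>C x))\<^sup>2 = (cmod c * norm x)\<^sup>2"
    using of_real_eq_iff by blast
  then show ?thesis by (simp add: power2_eq_iff_nonneg)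
qed

lemma cnj_mult_unit: "cmod c = 1 \<Longrightarrow> c * cnj c = 1" "cmod c = 1 \<Longrightarrow> cnj c * c = 1"
  by (simp_all add: complex_norm_square[symmetric] mult.commute)

lemma phase_obtain:
  obtains c where "cmod c = 1" "c * z = of_real (cmod z)"
proof (cases "z = 0")
  case True then show ?thesis using that[of 1] by simp
next
  case False
  have "cnj z / cmod z * z = of_real (cmod z)"
    using False by (simp add: complex_norm_square[symmetric] mult.commute power2_eq_square)
  then show ?thesis using that[of "cnj z / cmod z"] False by (simp add: norm_divide)
qed

lemma cmod_cinner_le: "cmod (cinner x y) \<le> norm x * norm (y::'a::complex_hilbert_space)"
proof -
  obtain c where c: "cmod c = 1" "c * cinner x y = of_real (cmod (cinner x y))"
    using phase_obtain by blast
  have "cmod (cinner x y) = inner (c *\<^sub>C x) y"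
    using c by (simp add: inner_eq_Re_cinner cinner_simps)
  also have "\<dots> \<le> norm x * norm y"
    using norm_cauchy_schwarz[of "c *\<^sub>C x" y] c by simp
  finally show ?thesis .
qed

lemma bounded_linear_rank_one:
  "bounded_linear (\<lambda>u. cinner u v *\<^sub>C (v::'a::complex_hilbert_space))"
proof (rule bounded_linear_intro[where K = "norm v * norm v"])
  show "norm (cinner x v *\<^sub>C v) \<le> norm x * (norm v * norm v)" for x
    using mult_right_mono[OF cmod_cinner_le[of x v], of "norm v"] by (simp add: mult.assoc)
qed (simp_all add: cinner_simps scaleC_add_left scaleR_scaleC scaleC_scaleC)

text \<open>Kept for all \<open>v\<close>, not only unit vectors, because the quadratic dependence
  on \<open>v\<close> is polarised later. For a unit vector it is the orthogonal projection onto its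
  complex line.\<close>

definition rank_one :: "'a::complex_hilbert_space \<Rightarrow> ('a \<Rightarrow>\<^sub>L 'a)"
  where "rank_one v = Blinfun (\<lambda>u. cinner u v *\<^sub>C v)"

lemma rank_one_apply [simp]: "rank_one v u = cinner u v *\<^sub>C v"
  unfolding rank_one_def by (simp add: bounded_linear_Blinfun_apply bounded_linear_rank_one)

lemma BsI:
  assumes "\<And>c x. blinfun_apply A (c *\<^sub>C x) = c *\<^sub>C A x" "\<And>x y. cinner (A x) y = cinner x (A y)"
  shows "A \<in> Bs"
  using assms by (simp add: Bs_def clinear_op_def)

lemma Bs_scaleC: "A \<in> Bs \<Longrightarrow> blinfun_apply A (c *\<^sub>C x) = c *\<^sub>C A x"
  by (simp add: Bs_def clinear_op_def)

lemma Bs_cinner: "A \<in> Bs \<Longrightarrow> cinner (blinfun_apply A x) y = cinner x (A y)"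
  by (simp add: Bs_def)

lemma Bs_inner: "A \<in> Bs \<Longrightarrow> inner (blinfun_apply A x) y = inner x (A y)"
  by (simp add: Bs_cinner inner_eq_Re_cinner)

lemma Bs_rank_one [simp]: "rank_one v \<in> Bs"
proof (rule BsI)
  show "cinner (rank_one v x) y = cinner x (rank_one v y)" for x y
    by (simp add: cinner_simps mult.commute) (metis cinner_commute mult.commute)
qed (simp add: cinner_simps scaleC_scaleC)

lemma Bs_add [simp]: "A \<in> Bs \<Longrightarrow> B \<in> Bs \<Longrightarrow> A + B \<in> Bs"
  by (rule BsI) (simp_all add: blinfun.add_left Bs_scaleC Bs_cinner cinner_simps scaleC_add_right)

lemma Bs_scaleR [simp]: "A \<in> Bs \<Longrightarrow> r *\<^sub>R A \<in> Bs"
  by (rule BsI) (simp_all add: blinfun.scaleR_left Bs_scaleC Bs_cinner cinner_simps scaleC_scaleR)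

lemma Bs_minus [simp]: "A \<in> Bs \<Longrightarrow> - A \<in> Bs"
  using Bs_scaleR[of A "-1"] by simp

lemma Bs_diff [simp]: "A \<in> Bs \<Longrightarrow> B \<in> Bs \<Longrightarrow> A - B \<in> Bs"
  using Bs_add[of A "- B"] by simp

lemma Bs_id [simp]: "id_blinfun \<in> Bs"
  by (rule BsI) simp_all

lemma Bs_zero [simp]: "0 \<in> Bs"
  by (rule BsI) simp_all

lemma subspace_Bs: "subspace Bs"
  by (simp add: subspace_def)

lemma Bs_square: "A \<in> Bs \<Longrightarrow> A o\<^sub>L A \<in> Bs"
  by (rule BsI) (simp_all add: Bs_scaleC Bs_cinner)

lemma inner_rank_one: "inner (rank_one v u) u = (cmod (cinner u v))\<^sup>2"
proof -
  have "cinner (rank_one v u) u = cinner u v * cnj (cinner u v)"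
    by (simp add: cinner_simps) (metis cinner_commute)
  then show ?thesis by (simp add: inner_eq_Re_cinner complex_norm_square[symmetric])
qed

lemma rank_one_scaleC: "rank_one (c *\<^sub>C v) = (cmod c)\<^sup>2 *\<^sub>R rank_one v"
  by (rule blinfun_eqI)
    (simp add: cinner_simps scaleC_scaleC blinfun.scaleR_left scaleR_scaleC mult_cnj_left mult_ac)

lemma rank_one_scaleR: "rank_one (r *\<^sub>R v) = r\<^sup>2 *\<^sub>R rank_one v"
  by (simp add: scaleR_scaleC[of r v] rank_one_scaleC)

lemma rank_one_unit: "norm v = 1 \<Longrightarrow> rank_one v v = v"
  by (simp add: cinner_self)

text \<open>The mixed terms cancel. Later this recovers \<open>rank_one x\<close> from the
  projections onto the two diagonals \<open>e0 + x\<close>, \<open>e0 - x\<close> and onto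
  \<open>e0\<close>.\<close>

lemma rank_one_parallelogram:
  "rank_one (x + y) + rank_one (x - y) = 2 *\<^sub>R rank_one x + 2 *\<^sub>R rank_one y"
proof (rule blinfun_eqI)
  fix u :: 'a
  have *: "rank_one (x + y) u = cinner u x *\<^sub>C x + cinner u y *\<^sub>C x + cinner u x *\<^sub>C y + cinner u y *\<^sub>C y" for y
    by (simp add: cinner_simps scaleC_add_left scaleC_add_right algebra_simps)
  show "(rank_one (x + y) + rank_one (x - y)) u = (2 *\<^sub>R rank_one x + 2 *\<^sub>R rank_one y) u"
    using *[of y] *[of "- y"]
    by (simp add: blinfun.add_left blinfun.scaleR_left scaleR_2 del: rank_one_apply) simp
qed

lemma ortho_obtain:
  fixes x :: "'a::complex_hilbert_space"
  assumes "norm x = 1"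
  obtains w where "y = cinner y x *\<^sub>C x + w" "cinner w x = 0"
  using assms by (intro that[of "y - cinner y x *\<^sub>C x"]) (simp_all add: cinner_simps cinner_self)

subsection \<open>The maximal deviation\<close>

lemma cinner_Bs_self: "A \<in> Bs \<Longrightarrow> cinner (blinfun_apply A x) x = of_real (inner (A x) x)"
  by (rule complex_eqI) (simp_all add: inner_eq_Re_cinner, metis Bs_cinner cinner_commute
      complex_cnj_cancel_iff complex_In_mult_cnj_zero Im_complex_of_real Reals_cnj_iff complex_is_Real_iff)

text \<open>\<open>y\<close> is the component of \<open>A x\<close> orthogonal to \<open>x\<close>,
  so Pythagoras turns the variance into a squared length. By the third identity the normalised
  \<open>y\<close> attains the standard deviation as a matrix entry of \<open>A\<close>.\<close>

lemma variance_residual: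
  assumes "A \<in> Bs" "norm x = 1"
  defines "y \<equiv> A x - inner (A x) x *\<^sub>R x"
  shows "variance_op A x = (norm y)\<^sup>2" "cinner y x = 0" "inner (A x) y = (norm y)\<^sup>2"
proof -
  have xx: "inner x x = 1" using assms(2) by (simp add: norm_eq_sqrt_inner)
  have v: "variance_op A x = inner (A x) (A x) - (inner (A x) x)\<^sup>2"
    using assms(1) by (simp add: variance_op_def inner_eq_Re_cinner Bs_cinner)
  show "variance_op A x = (norm y)\<^sup>2"
    unfolding power2_norm_eq_inner v
    by (simp add: y_def inner_diff_left inner_diff_right xx power2_eq_square inner_commute)
  show "inner (A x) y = (norm y)\<^sup>2"
    unfolding power2_norm_eq_inner
    by (simp add: y_def inner_diff_left inner_diff_right xx power2_eq_square inner_commute)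
  show "cinner y x = 0"
    using assms(2) by (simp add: y_def cinner_simps cinner_self cinner_Bs_self[OF assms(1)])
qed

text \<open>Pairing with a vector orthogonal to \<open>x\<close> discards the mean part of
  \<open>A x\<close>; what remains is the residual, whose length is the standard deviation at
  \<open>x\<close>.\<close>

lemma max_deviation_ge_unit:
  assumes A: "A \<in> Bs" and x: "norm x = 1" and o: "cinner x y = 0"
  shows "inner (A x) y \<le> max_deviation A * norm y"
proof -
  define z where "z = A x - inner (A x) x *\<^sub>R x"
  have "inner (A x) y = inner z y"
    using cinner_0_inner[OF o] by (simp add: z_def inner_diff_left)
  also have "\<dots> \<le> norm z * norm y" by (rule norm_cauchy_schwarz)
  also have "norm z = sqrt (variance_op A x)"
    using variance_residual(1)[OF A x] by (simp add: z_def)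
  also have "\<dots> \<le> max_deviation A"
    unfolding max_deviation_def
    by (rule cSUP_upper) (use x bdd_above_variance_op[OF A] in auto)
  finally show ?thesis by (simp add: mult_right_mono)
qed

lemma max_deviation_ge:
  assumes A: "A \<in> Bs" and o: "cinner x y = 0"
  shows "inner (A x) y \<le> max_deviation A * norm x * norm y"
proof (cases "x = 0")
  case False
  have "inner (A (x /\<^sub>R norm x)) y \<le> max_deviation A * norm y"
    using False o by (intro max_deviation_ge_unit A) (simp_all add: cinner_simps)
  then show ?thesis using False
    by (simp add: blinfun.scaleR_right divide_simps mult.commute mult.left_commute)
qed simp

text \<open>The normalised residual of \<open>A x\<close> is an admissible \<open>y\<close>, so
  \<open>max_deviation_ge\<close> is sharp and the maximal deviation is a supremum of expressions
  linear in \<open>A\<close>. The vector \<open>e\<close> ensures that the supremum runs over a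
  nonempty set.\<close>

lemma max_deviation_le:
  fixes A :: "'a::complex_hilbert_space \<Rightarrow>\<^sub>L 'a"
  assumes A: "A \<in> Bs" and e: "norm (e::'a) = 1" and c: "0 \<le> c"
    and le: "\<And>x y. norm x = 1 \<Longrightarrow> norm y = 1 \<Longrightarrow> cinner x y = 0 \<Longrightarrow> inner (A x) y \<le> c"
  shows "max_deviation A \<le> c"
  unfolding max_deviation_def
proof (rule cSUP_least)
  show "{x::'a. norm x = 1} \<noteq> {}" using e by blast
  fix x :: 'a assume "x \<in> {x. norm x = 1}"
  then have x: "norm x = 1" by simp
  define y where "y = A x - inner (A x) x *\<^sub>R x"
  note y = variance_residual[OF A x, folded y_def]
  have "norm y \<le> c"
  proof (cases "y = 0")
    case False
    have "inner (A x) (y /\<^sub>R norm y) \<le> c"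
      using False y(2) by (intro le x) (simp_all add: cinner_simps cinner_eq_0_commute)
    then show ?thesis using False y(3) by (simp add: power2_eq_square field_simps)
  qed (use c in simp)
  then show "sqrt (variance_op A x) \<le> c" by (simp add: y(1))
qed

text \<open>Once the phase of \<open>u\<close> makes \<open>cinner u v\<close> a real
  \<open>g \<ge> 0\<close>, sum and difference are orthogonal, the left side is the matrix entry of
  \<open>A\<close> between them, and their lengths multiply to \<open>2 * sqrt (1 - g^2)\<close>.
  This factor is kept because it makes \<open>m_rank_one_diff\<close> exact.\<close>

lemma max_deviation_form:
  assumes A: "A \<in> Bs" and u: "norm u = 1" and v: "norm v = 1"
  shows "inner (A u) u - inner (A v) v
    \<le> 2 * max_deviation A * sqrt (1 - (cmod (cinner u v))\<^sup>2)"
proof -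
  define g where "g = cmod (cinner u v)"
  obtain c where c: "cmod c = 1" "c * cinner u v = of_real g"
    using phase_obtain g_def by blast
  define w where "w = c *\<^sub>C u"
  have w: "norm w = 1" using c u by (simp add: w_def)
  have wv: "cinner w v = of_real g" using c by (simp add: w_def cinner_simps)
  have vw: "cinner v w = of_real g" using wv cinner_commute[of v w] by simp
  have iwv: "inner w v = g" using wv by (simp add: inner_eq_Re_cinner)
  have "inner (A w) w = inner (A u) u"
    using c by (simp add: w_def Bs_scaleC[OF A] inner_eq_Re_cinner cinner_simps cnj_mult_unit
        flip: mult.assoc)
  then have "inner (A u) u - inner (A v) v = inner (A (w + v)) (w - v)"
    using Bs_inner[OF A, of w v]
    by (simp add: blinfun.add_right inner_simps inner_commute)
  also have "\<dots> \<le> max_deviation A * norm (w + v) * norm (w - v)"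
    by (rule max_deviation_ge[OF A]) (simp add: cinner_simps cinner_self w v wv vw)
  also have "norm (w + v) = sqrt (2 + 2 * g)"
    using w v iwv by (simp add: norm_eq_sqrt_inner inner_simps inner_commute)
  also have "norm (w - v) = sqrt (2 - 2 * g)"
    using w v iwv by (simp add: norm_eq_sqrt_inner inner_simps inner_commute)
  also have "max_deviation A * sqrt (2 + 2 * g) * sqrt (2 - 2 * g)
      = max_deviation A * sqrt (2\<^sup>2 * (1 - g\<^sup>2))"
    by (simp add: mult.assoc algebra_simps power2_eq_square flip: real_sqrt_mult)
  finally show ?thesis by (simp only: real_sqrt_mult g_def) simp
qed

lemma max_deviation_nonneg:
  fixes A :: "'a::complex_hilbert_space \<Rightarrow>\<^sub>L 'a"
  assumes A: "A \<in> Bs" and e: "norm (e::'a) = 1"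
  shows "0 \<le> max_deviation A"
proof -
  have "0 \<le> sqrt (variance_op A e)"
    using variance_op_bounds(1)[OF A e] by simp
  also have "\<dots> \<le> max_deviation A"
    unfolding max_deviation_def
    by (rule cSUP_upper) (use e bdd_above_variance_op[OF A] in auto)
  finally show ?thesis .
qed

text \<open>For orthonormal \<open>x\<close>, \<open>y\<close> the vectors
  \<open>(x + y) / sqrt 2\<close> and \<open>(x - y) / sqrt 2\<close> are orthonormal too, and their
  form values differ by \<open>2 * inner (A x) y\<close>.\<close>

lemma max_deviation_le_form:
  fixes A :: "'a::complex_hilbert_space \<Rightarrow>\<^sub>L 'a"
  assumes A: "A \<in> Bs" and e: "norm (e::'a) = 1" and c: "0 \<le> c"
    and le: "\<And>u v. norm u = 1 \<Longrightarrow> norm v = 1 \<Longrightarrow> cinner u v = 0 \<Longrightarrow>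
      inner (A u) u - inner (A v) v \<le> 2 * c"
  shows "max_deviation A \<le> c"
proof (rule max_deviation_le[OF A e c])
  fix x y :: 'a assume x: "norm x = 1" and y: "norm y = 1" and o: "cinner x y = 0"
  define r where "r = inverse (sqrt 2)"
  have r: "r * r = 1 / 2" by (simp add: r_def flip: inverse_mult_distrib)
  have o': "cinner y x = 0" "inner x y = 0" "inner y x = 0"
    using o cinner_eq_0_commute cinner_0_inner by blast+
  have n: "norm (x + y) = sqrt 2" "norm (x - y) = sqrt 2"
    using x y o' by (simp_all add: norm_eq_sqrt_inner inner_simps)
  have "inner (A (r *\<^sub>R (x + y))) (r *\<^sub>R (x + y)) - inner (A (r *\<^sub>R (x - y))) (r *\<^sub>R (x - y)) \<le> 2 * c"
    by (rule le) (simp_all add: n r_def cinner_simps cinner_self x y o o')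
  moreover have "inner (A (r *\<^sub>R (x + y))) (r *\<^sub>R (x + y)) - inner (A (r *\<^sub>R (x - y))) (r *\<^sub>R (x - y))
      = r * r * (4 * inner (A x) y)"
    using Bs_inner[OF A, of x y]
    by (simp add: blinfun.scaleR_right blinfun.add_right blinfun.diff_right inner_simps
        inner_commute algebra_simps)
  ultimately show "inner (A x) y \<le> c" by (simp add: r)
qed

lemma max_deviation_triangle:
  fixes A :: "'a::complex_hilbert_space \<Rightarrow>\<^sub>L 'a"
  assumes A: "A \<in> Bs" and B: "B \<in> Bs" and e: "norm (e::'a) = 1"
  shows "max_deviation (A + B) \<le> max_deviation A + max_deviation B"
proof (rule max_deviation_le[OF _ e])
  fix x y :: 'a assume "norm x = 1" "norm y = 1" "cinner x y = 0"
  then show "inner ((A + B) x) y \<le> max_deviation A + max_deviation B"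
    using max_deviation_ge[OF A, of x y] max_deviation_ge[OF B, of x y]
    by (simp add: blinfun.add_left inner_simps)
qed (use A B max_deviation_nonneg[OF A e] max_deviation_nonneg[OF B e] in auto)

lemma max_deviation_scaleR_le:
  fixes A :: "'a::complex_hilbert_space \<Rightarrow>\<^sub>L 'a"
  assumes A: "A \<in> Bs" and e: "norm (e::'a) = 1"
  shows "max_deviation (r *\<^sub>R A) \<le> \<bar>r\<bar> * max_deviation A"
proof (rule max_deviation_le[OF _ e])
  fix x y :: 'a assume xy: "norm x = 1" "norm y = 1" "cinner x y = 0"
  have "\<bar>inner (A x) y\<bar> \<le> max_deviation A"
    using max_deviation_ge[OF A, of x y] max_deviation_ge[OF A, of x "- y"] xy by simp
  then have "\<bar>r\<bar> * \<bar>inner (A x) y\<bar> \<le> \<bar>r\<bar> * max_deviation A"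
    by (intro mult_left_mono) auto
  then show "inner ((r *\<^sub>R A) x) y \<le> \<bar>r\<bar> * max_deviation A"
    by (simp add: blinfun.scaleR_left flip: abs_mult)
qed (use A max_deviation_nonneg[OF A e] in auto)

lemma max_deviation_scaleR:
  fixes A :: "'a::complex_hilbert_space \<Rightarrow>\<^sub>L 'a"
  assumes A: "A \<in> Bs" and e: "norm (e::'a) = 1"
  shows "max_deviation (r *\<^sub>R A) = \<bar>r\<bar> * max_deviation A"
proof (cases "r = 0")
  case True
  have "max_deviation (0 :: 'a \<Rightarrow>\<^sub>L 'a) \<le> 0"
    using e by (intro max_deviation_le[OF _ e]) auto
  moreover have "0 \<le> max_deviation (0 :: 'a \<Rightarrow>\<^sub>L 'a)"
    using e by (intro max_deviation_nonneg) auto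
  ultimately show ?thesis using True by simp
next
  case False
  have "max_deviation (inverse r *\<^sub>R (r *\<^sub>R A)) \<le> \<bar>inverse r\<bar> * max_deviation (r *\<^sub>R A)"
    using A e by (intro max_deviation_scaleR_le) auto
  then have "\<bar>r\<bar> * max_deviation A \<le> max_deviation (r *\<^sub>R A)"
    using False by (simp add: field_simps)
  then show ?thesis using max_deviation_scaleR_le[OF A e, of r] by linarith
qed

text \<open>On \<open>Bs\<close> this is equality in the quotient by the null space of
  \<open>max_deviation\<close>. A relation instead of a quotient type keeps representatives
  available for evaluation at vectors, which is how the scalar \<open>c\<close> is found
  later.\<close>

definition eq_mod_scalar :: "('a::complex_hilbert_space \<Rightarrow>\<^sub>L 'a) \<Rightarrow> ('a \<Rightarrow>\<^sub>L 'a) \<Rightarrow> bool"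
    (infix "\<simeq>" 50)
  where "A \<simeq> B \<longleftrightarrow> (\<exists>c. A = B + c *\<^sub>R id_blinfun)"

lemma eqv_refl [simp, intro]: "A \<simeq> A"
  by (auto simp: eq_mod_scalar_def intro: exI[of _ 0])

lemma eqv_add: "A \<simeq> B \<Longrightarrow> C \<simeq> D \<Longrightarrow> A + C \<simeq> B + D"
  by (auto simp: eq_mod_scalar_def scaleR_add_left[symmetric] add_ac intro: exI[of _ "_ + _"])

lemma eqv_scaleR: "A \<simeq> B \<Longrightarrow> r *\<^sub>R A \<simeq> r *\<^sub>R B"
  by (auto simp: eq_mod_scalar_def scaleR_add_right intro: exI[of _ "r * _"])

lemma eqv_sym: "A \<simeq> B \<Longrightarrow> B \<simeq> A"
  by (auto simp: eq_mod_scalar_def intro: exI[of _ "- _"])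

lemma eqv_trans [trans]: "A \<simeq> B \<Longrightarrow> B \<simeq> C \<Longrightarrow> A \<simeq> C"
  by (auto simp: eq_mod_scalar_def scaleR_add_left[symmetric] add_ac intro: exI[of _ "_ + _"])

lemma eqv_minus: "A \<simeq> B \<Longrightarrow> - A \<simeq> - B"
  using eqv_scaleR[of A B "-1"] by simp

lemma eqv_diff: "A \<simeq> B \<Longrightarrow> C \<simeq> D \<Longrightarrow> A - C \<simeq> B - D"
  using eqv_add[of A B "- C" "- D"] eqv_minus[of C D] by simp

lemma eqv_add_scalar [simp]: "A + c *\<^sub>R id_blinfun \<simeq> A"
  by (auto simp: eq_mod_scalar_def)

lemma eqv_apply:
  assumes "A \<simeq> B"
  obtains c where "\<And>x. blinfun_apply A x = B x + c *\<^sub>R x"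
proof -
  from assms obtain c where "A = B + c *\<^sub>R id_blinfun" by (auto simp: eq_mod_scalar_def)
  then show thesis by (intro that[of c]) (simp add: blinfun.add_left blinfun.scaleR_left)
qed

lemma max_deviation_scalar:
  fixes e :: "'a::complex_hilbert_space"
  assumes e: "norm e = 1"
  shows "max_deviation (c *\<^sub>R id_blinfun :: 'a \<Rightarrow>\<^sub>L 'a) = 0"
proof (rule antisym)
  show "max_deviation (c *\<^sub>R id_blinfun :: 'a \<Rightarrow>\<^sub>L 'a) \<le> 0"
    by (rule max_deviation_le[OF _ e])
      (simp_all add: blinfun.scaleR_left cinner_0_inner)
qed (use e in \<open>auto intro!: max_deviation_nonneg\<close>)

lemma max_deviation_cong:
  fixes A :: "'a::complex_hilbert_space \<Rightarrow>\<^sub>L 'a"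
  assumes "A \<simeq> B" "A \<in> Bs" "B \<in> Bs" and e: "norm (e::'a) = 1"
  shows "max_deviation A = max_deviation B"
proof -
  have "max_deviation A \<le> max_deviation B"
    if AB: "A \<simeq> B" "A \<in> Bs" "B \<in> Bs" for A B :: "'a \<Rightarrow>\<^sub>L 'a"
  proof -
    obtain c where c: "A = B + c *\<^sub>R id_blinfun" using AB(1) by (auto simp: eq_mod_scalar_def)
    show ?thesis
      using max_deviation_triangle[OF AB(3) _ e, of "c *\<^sub>R id_blinfun"] max_deviation_scalar[OF e, of c]
      by (simp add: c)
  qed
  then show ?thesis using assms(1-3) eqv_sym by (metis antisym)
qed

text \<open>The residual of \<open>A x\<close> is orthogonal to \<open>x\<close>, so it vanishes and
  every unit vector is an eigenvector; testing on \<open>e + f\<close> and \<open>e - f\<close>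
  equates the eigenvalues of orthogonal unit vectors. In dimensions zero and one the hypothesis
  \<open>z\<close> is vacuous, which settles those cases of the theorem.\<close>

lemma scalarI:
  fixes A :: "'a::complex_hilbert_space \<Rightarrow>\<^sub>L 'a"
  assumes A: "A \<in> Bs" and z: "\<And>x y. norm x = 1 \<Longrightarrow> norm y = 1 \<Longrightarrow> cinner x y = 0 \<Longrightarrow> inner (A x) y = 0"
  shows "A \<simeq> 0"
proof (cases "\<exists>e::'a. norm e = 1")
  case True
  then obtain e :: 'a where e: "norm e = 1" by blast
  have z': "inner (A x) y = 0" if "cinner x y = 0" for x y
  proof (cases "x = 0 \<or> y = 0")
    case False
    have "inner (A (x /\<^sub>R norm x)) (y /\<^sub>R norm y) = 0"
      using False that by (intro z) (simp_all add: cinner_simps)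
    then show ?thesis using False by (simp add: blinfun.scaleR_right)
  qed auto
  define l where "l x = inner (A x) x" for x
  have eig: "A x = l x *\<^sub>R x" if x: "norm x = 1" for x
  proof -
    define y where "y = A x - l x *\<^sub>R x"
    note y = variance_residual[OF A x, folded l_def, folded y_def]
    have "inner (A x) y = 0" by (rule z'[OF cinner_eq_0_commute[OF y(2)]])
    then show ?thesis using y(3) by (simp add: y_def)
  qed
  have "A x = l e *\<^sub>R x" for x
  proof -
    obtain w where w: "x = cinner x e *\<^sub>C e + w" "cinner w e = 0"
      using ortho_obtain[OF e] by blast
    have "A w = l e *\<^sub>R w"
    proof (cases "w = 0")
      case False
      define f where "f = w /\<^sub>R norm w"
      have f: "norm f = 1" "w = norm w *\<^sub>R f" using False by (simp_all add: f_def)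
      have ef: "cinner e f = 0" "cinner f e = 0" "inner e f = 0" "inner f e = 0"
        using w(2) cinner_eq_0_commute[OF w(2)] cinner_0_inner[OF w(2)]
        by (simp_all add: f_def cinner_simps inner_commute)
      have "inner (A (e + f)) (e - f) = 0"
        by (rule z') (use e f ef in \<open>simp add: cinner_simps cinner_self\<close>)
      then have "l e = l f"
        using eig[OF e] eig[OF f(1)] e f ef
        by (simp add: blinfun.add_right inner_simps norm_eq_1)
      then show ?thesis using eig[OF f(1)] f(2) by (metis blinfun.scaleR_right scaleR_left_commute)
    qed simp
    then have "A (cinner x e *\<^sub>C e + w) = l e *\<^sub>R (cinner x e *\<^sub>C e + w)"
      using eig[OF e] by (simp add: blinfun.add_right Bs_scaleC[OF A] scaleC_scaleR scaleR_add_right)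
    then show ?thesis using w(1) by simp
  qed
  then have "A = 0 + l e *\<^sub>R id_blinfun"
    by (intro blinfun_eqI) (simp add: blinfun.scaleR_left)
  then show ?thesis using eq_mod_scalar_def by blast
next
  case False
  have "x = 0" for x :: 'a
  proof (rule ccontr)
    assume "x \<noteq> 0"
    then have "norm (x /\<^sub>R norm x) = 1" by simp
    then show False using False by blast
  qed
  then have "A = 0" by (intro blinfun_eqI) metis
  then show ?thesis by simp
qed

lemma max_deviation_zero_iff:
  fixes A :: "'a::complex_hilbert_space \<Rightarrow>\<^sub>L 'a"
  assumes A: "A \<in> Bs" and e: "norm (e::'a) = 1"
  shows "max_deviation A = 0 \<longleftrightarrow> A \<simeq> 0"
proof
  assume m: "max_deviation A = 0"
  show "A \<simeq> 0"
  proof (rule scalarI[OF A])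
    fix x y :: 'a assume "cinner x y = 0"
    then show "inner (A x) y = 0"
      using max_deviation_ge[OF A, of x y] max_deviation_ge[OF A, of x "- y"] m by simp
  qed
next
  assume "A \<simeq> 0"
  then show "max_deviation A = 0"
    using max_deviation_cong[OF _ A _ e, of 0] max_deviation_scalar[OF e, of 0] by simp
qed

lemma eqv_iff:
  fixes A :: "'a::complex_hilbert_space \<Rightarrow>\<^sub>L 'a"
  assumes "A \<in> Bs" "B \<in> Bs" and e: "norm (e::'a) = 1"
  shows "A \<simeq> B \<longleftrightarrow> max_deviation (A - B) = 0"
  using assms max_deviation_zero_iff[of "A - B" e] eqv_diff[of A B B B] eqv_add[of "A - B" 0 B B]
  by auto

subsection \<open>Isometries of a seminorm are affine up to null vectors\<close>

text \<open>Only a seminorm, since \<open>max_deviation\<close> vanishes on scalars, and only on a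
  subspace, since it is controlled on \<open>Bs\<close> alone. Midpoints are therefore preserved up
  to vectors of seminorm zero.\<close>

locale seminorm_on =
  fixes S :: "'v::real_vector set" and N :: "'v \<Rightarrow> real"
  assumes subspace: "subspace S"
    and triangle: "x \<in> S \<Longrightarrow> y \<in> S \<Longrightarrow> N (x + y) \<le> N x + N y"
    and scaleR: "x \<in> S \<Longrightarrow> N (r *\<^sub>R x) = \<bar>r\<bar> * N x"
begin

lemma mem [simp]: "x \<in> S \<Longrightarrow> y \<in> S \<Longrightarrow> x + y \<in> S" "x \<in> S \<Longrightarrow> y \<in> S \<Longrightarrow> x - y \<in> S"
  "x \<in> S \<Longrightarrow> r *\<^sub>R x \<in> S" "0 \<in> S"
  using subspace by (auto simp: subspace_add subspace_diff subspace_scale subspace_0)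

lemma zero [simp]: "N 0 = 0"
  using scaleR[of 0 0] by simp

lemma sym: "x \<in> S \<Longrightarrow> y \<in> S \<Longrightarrow> N (x - y) = N (y - x)"
  using scaleR[of "x - y" "-1"] by simp

lemma nonneg: "x \<in> S \<Longrightarrow> 0 \<le> N x"
  using triangle[of x "(-1) *\<^sub>R x"] scaleR[of x "-1"] mem(3)[of x "-1"] by simp

lemma dist_triangle: "x \<in> S \<Longrightarrow> y \<in> S \<Longrightarrow> z \<in> S \<Longrightarrow> N (x - z) \<le> N (x - y) + N (y - z)"
  using triangle[of "x - y" "y - z"] by simp

definition isom :: "('v \<Rightarrow> 'v) \<Rightarrow> bool"
  where "isom f \<longleftrightarrow> bij_betw f S S \<and> (\<forall>x\<in>S. \<forall>y\<in>S. N (f x - f y) = N (x - y))"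

lemma isom_mem: "isom f \<Longrightarrow> x \<in> S \<Longrightarrow> f x \<in> S"
  by (auto simp: isom_def bij_betw_apply)

lemma isom_comp: "isom f \<Longrightarrow> isom g \<Longrightarrow> isom (f \<circ> g)"
  using isom_mem by (auto simp: isom_def intro: bij_betw_trans)

lemma isom_inv:
  assumes "isom f"
  shows "isom (inv_into S f)"
proof -
  have b: "bij_betw f S S" and d: "\<And>x y. x \<in> S \<Longrightarrow> y \<in> S \<Longrightarrow> N (f x - f y) = N (x - y)"
    using assms by (auto simp: isom_def)
  have i: "inv_into S f x \<in> S" "f (inv_into S f x) = x" if "x \<in> S" for x
    using that bij_betw_inv_into_right[OF b] bij_betw_apply[OF bij_betw_inv_into[OF b]] by auto
  show ?thesis
    unfolding isom_def using bij_betw_inv_into[OF b] d i by metis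
qed

lemma isom_reflect: "a \<in> S \<Longrightarrow> isom (\<lambda>x. a - x)"
  unfolding isom_def
  by (intro conjI bij_betw_byWitness[where f' = "\<lambda>x. a - x"]) (auto simp: sym)

text \<open>
  Vaisala's argument: conjugating with the reflection in the midpoint doubles the
  displacement of the midpoint, which stays bounded.
\<close>

lemma fix_midpoint:
  assumes a: "a \<in> S" and b: "b \<in> S"
    and g: "isom g" "N (g a - a) = 0" "N (g b - b) = 0"
  defines "z \<equiv> (1/2) *\<^sub>R (a + b)"
  shows "N (g z - z) = 0"
proof -
  define W where "W = {g. isom g \<and> N (g a - a) = 0 \<and> N (g b - b) = 0}"
  have zS: "z \<in> S" using a b by (simp add: z_def)
  have z2: "z + z = a + b" by (simp add: z_def flip: scaleR_2)
  have bound: "N (g z - z) \<le> 2 * N (z - a)" if "g \<in> W" for g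
  proof -
    have g: "isom g" "N (g a - a) = 0" using that by (auto simp: W_def)
    have "N (g z - z) \<le> N (g z - g a) + (N (g a - a) + N (a - z))"
      using dist_triangle[of "g z" "g a" z] dist_triangle[of "g a" a z] g a zS isom_mem by simp
    also have "N (g z - g a) = N (z - a)" using g a zS by (simp add: isom_def)
    finally show ?thesis using g(2) sym[OF a zS] by simp
  qed
  have double: "\<exists>h\<in>W. N (h z - z) = 2 * N (g z - z)" if "g \<in> W" for g
  proof -
    have g: "isom g" "N (g a - a) = 0" "N (g b - b) = 0" using that by (auto simp: W_def)
    define g' where "g' = inv_into S g"
    define r where "r x = a + b - x" for x
    define h where "h = r \<circ> g' \<circ> r \<circ> g"
    have r: "isom r" using isom_reflect[of "a + b"] a b by (simp add: r_def[abs_def])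
    have g': "isom g'" using isom_inv[OF g(1)] by (simp add: g'_def)
    have g'g: "g' (g x) = x" if "x \<in> S" for x
      using g(1) that bij_betw_inv_into_left[of g S S] by (simp add: isom_def g'_def)
    have gm: "g x \<in> S" "g' x \<in> S" "r x \<in> S" if "x \<in> S" for x
      using g g' r isom_mem that by auto
    have isos: "N (g' x - g' y) = N (x - y)" "N (r x - r y) = N (x - y)" "N (g x - g y) = N (x - y)"
      if "x \<in> S" "y \<in> S" for x y
      using that g g' r by (auto simp: isom_def)
    have rr: "r (r x) = x" "r a = b" "r b = a" "r z = z" for x
      using z2 by (simp_all add: r_def diff_eq_eq)
    have inv: "N (g' x - x) = N (g x - x)" if "x \<in> S" for x
      using isos(1)[of x "g x"] that gm g'g sym[of x "g x"] by simp
    \<comment> \<open>\<open>g\<close> fixes \<open>a\<close> and \<open>b\<close> only up to null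
      vectors, so the error is carried through the triangle inequality. Since \<open>r\<close> swaps
      \<open>x\<close> and \<open>y\<close>, one argument covers both \<open>a\<close> and
      \<open>b\<close>.\<close>
    have key: "N (h x - x) = 0" if x: "x \<in> S" "y \<in> S" and y: "r x = y" "r y = x"
      and 0: "N (g x - x) = 0" "N (g y - y) = 0" for x y
    proof -
      have "N (h x - x) = N (r (g' (r (g x))) - r y)" using y by (simp add: h_def)
      also have "\<dots> = N (g' (r (g x)) - y)" using x gm by (simp add: isos)
      also have "\<dots> \<le> N (g' (r (g x)) - g' y) + N (g' y - y)"
        using dist_triangle x gm by simp
      also have "N (g' (r (g x)) - g' y) = N (r (g x) - r x)" using x gm y by (simp add: isos)
      also have "\<dots> = 0" using x gm 0 by (simp add: isos)
      also have "N (g' y - y) = 0" using inv x 0 by simp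
      finally show ?thesis using nonneg[of "h x - x"] x gm by (simp add: h_def)
    qed
    have "isom h" unfolding h_def using g g' r isom_comp by blast
    moreover have "N (h a - a) = 0" "N (h b - b) = 0"
      using key[of a b] key[of b a] a b rr g by auto
    ultimately have "h \<in> W" by (simp add: W_def)
    moreover have "N (h z - z) = 2 * N (g z - z)"
    proof -
      have "N (h z - z) = N (r (g' (r (g z))) - r z)" using rr by (simp add: h_def)
      also have "\<dots> = N (g' (r (g z)) - g' (g z))" using zS gm g'g by (simp add: isos)
      also have "\<dots> = N (r (g z) - g z)" using zS gm by (simp add: isos)
      also have "r (g z) - g z = 2 *\<^sub>R (z - g z)"
        unfolding r_def z2[symmetric] by (simp add: scaleR_2 scaleR_diff_right)
      finally show ?thesis using scaleR[of "z - g z" 2] sym[of z "g z"] zS gm by simp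
    qed
    ultimately show ?thesis by blast
  qed
  have gW: "g \<in> W" using g by (simp add: W_def)
  have bdd: "bdd_above ((\<lambda>g. N (g z - z)) ` W)" using bound by (rule bdd_aboveI2)
  define L where "L = (SUP g\<in>W. N (g z - z))"
  have le: "N (g z - z) \<le> L" if "g \<in> W" for g
    unfolding L_def using bdd that by (rule cSUP_upper2) simp
  have "2 * N (g z - z) \<le> L" if "g \<in> W" for g
    using double[OF that] le by metis
  then have "L \<le> L / 2"
    unfolding L_def[symmetric] by (subst L_def, intro cSUP_least) (use gW in \<open>auto simp: mult.commute\<close>)
  then show ?thesis using le[OF gW] nonneg[of "g z - z"] isom_mem[OF g(1)] zS by simp
qed

text \<open>With \<open>r\<close> and \<open>s\<close> the point reflections in the midpoints of
  \<open>a\<close>, \<open>b\<close> and of \<open>f a\<close>, \<open>f b\<close>, the isometry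
  \<open>g\<close> fixes \<open>a\<close> and \<open>b\<close>, hence \<open>z\<close> up to a null
  vector. As \<open>r z = z\<close>, this places \<open>s (f z)\<close> at distance zero from
  \<open>f z\<close>, so \<open>f z\<close> is the centre of \<open>s\<close> up to a null
  vector.\<close>

lemma isom_midpoint:
  assumes f: "isom f" and a: "a \<in> S" and b: "b \<in> S"
  shows "N (f ((1/2) *\<^sub>R (a + b)) - (1/2) *\<^sub>R (f a + f b)) = 0"
proof -
  define f' where "f' = inv_into S f"
  define z where "z = (1/2) *\<^sub>R (a + b)"
  define r s where "r x = a + b - x" and "s x = f a + f b - x" for x
  define g where "g = f' \<circ> s \<circ> f \<circ> r"
  have fS: "f x \<in> S" if "x \<in> S" for x using f isom_mem that by auto
  have f': "isom f'" using isom_inv[OF f] by (simp add: f'_def)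
  have f'f: "f' (f x) = x" if "x \<in> S" for x
    using f that bij_betw_inv_into_left[of f S S] by (simp add: isom_def f'_def)
  have zS: "z \<in> S" using a b by (simp add: z_def)
  have "isom r" "isom s" using isom_reflect a b fS by (simp_all add: r_def[abs_def] s_def[abs_def])
  then have g: "isom g" unfolding g_def using f f' isom_comp by blast
  have "g a = a" "g b = b" using a b fS f'f by (simp_all add: g_def r_def s_def)
  then have gz: "N (g z - z) = 0" using fix_midpoint[OF a b g] by (simp add: z_def)
  have rz: "r z = z"
  proof -
    have "z + z = a + b" by (simp add: z_def flip: scaleR_2)
    then show ?thesis by (simp add: r_def diff_eq_eq)
  qed
  have "N (g z - z) = N (f' (s (f z)) - f' (f z))" using zS by (simp add: g_def rz f'f)
  also have "\<dots> = N (s (f z) - f z)" using f' zS fS a b by (simp add: isom_def s_def)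
  also have "s (f z) - f z = (-2) *\<^sub>R (f z - (1/2) *\<^sub>R (f a + f b))"
    by (simp add: s_def scaleR_diff_right scaleR_2)
  also have "N \<dots> = 2 * N (f z - (1/2) *\<^sub>R (f a + f b))"
    using zS a b fS scaleR[of "f z - (1/2) *\<^sub>R (f a + f b)" "-2"] by simp
  finally show ?thesis using gz by (simp add: z_def)
qed

end

subsection \<open>Extreme points of the unit ball\<close>

lemma psd_Cauchy_Schwarz:
  assumes T: "T \<in> Bs" and pos: "\<And>u. 0 \<le> inner (blinfun_apply T u) u"
  shows "(inner (T x) y)\<^sup>2 \<le> inner (T x) x * inner (T y) y"
proof -
  define a b c where "a = inner (T x) x" and "b = inner (T x) y" and "c = inner (T y) y"
  have q: "0 \<le> a + 2 * t * b + t\<^sup>2 * c" for t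
    using pos[of "x + t *\<^sub>R y"] Bs_inner[OF T, of x y]
    by (simp add: a_def b_def c_def blinfun.add_right blinfun.scaleR_right inner_simps inner_commute
        power2_eq_square algebra_simps)
  have "b\<^sup>2 \<le> a * c"
  proof (cases "c = 0")
    case True
    have "b = 0"
    proof (rule ccontr)
      assume "b \<noteq> 0"
      \<comment> \<open>For \<open>c = 0\<close> the quadratic is affine in \<open>t\<close>, and
        this \<open>t\<close> gives it the value -1.\<close>
      then show False using q[of "- (a + 1) / (2 * b)"] True by (simp add: field_simps)
    qed
    then show ?thesis using True by simp
  next
    case False
    then have "c > 0" using pos[of y] by (simp add: c_def)
    then show ?thesis using q[of "- b / c"] by (simp add: field_simps power2_eq_square)
  qed
  then show ?thesis by (simp add: a_def b_def c_def)
qed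

text \<open>Cauchy-Schwarz with \<open>y = T x\<close>. Applied to \<open>C\<close> and to
  \<open>id_blinfun - C\<close> below, it turns an extreme value of the form into an
  eigenvector.\<close>

lemma psd_zero:
  assumes "T \<in> Bs" and "\<And>u. 0 \<le> inner (blinfun_apply T u) u" and "inner (T x) x = 0"
  shows "T x = 0"
  using psd_Cauchy_Schwarz[OF assms(1,2), of x "T x"] assms(3) by simp

lemma form_normalize:
  "u \<noteq> 0 \<Longrightarrow> inner (blinfun_apply A u) u = (norm u)\<^sup>2 * inner (A (u /\<^sub>R norm u)) (u /\<^sub>R norm u)"
  by (simp add: blinfun.scaleR_right power2_eq_square field_simps)

lemma eigenvector_normalize:
  assumes "x \<noteq> 0" "blinfun_apply A (x /\<^sub>R norm x) = c *\<^sub>R (x /\<^sub>R norm x)"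
  shows "A x = c *\<^sub>R x"
  using arg_cong[OF assms(2), of "(*\<^sub>R) (norm x)"] assms(1) by (simp add: blinfun.scaleR_right)

section \<open>Orthogonal projections and extreme points\<close>

definition idem :: "('a::complex_hilbert_space \<Rightarrow>\<^sub>L 'a) \<Rightarrow> bool"
  where "idem P \<longleftrightarrow> P \<in> Bs \<and> (\<forall>x. P (P x) = P x)"

lemma idem_form: "idem P \<Longrightarrow> inner (blinfun_apply P u) u = (norm (P u))\<^sup>2"
  by (metis Bs_inner idem_def power2_norm_eq_inner inner_commute)

lemma idem_norm_le: "idem P \<Longrightarrow> norm (blinfun_apply P u) \<le> norm u"
  using idem_form[of P u] norm_cauchy_schwarz[of "P u" u]
  by (cases "P u = 0") (auto simp: power2_eq_square)

lemma idem_form_le: "idem P \<Longrightarrow> inner (blinfun_apply P u) u \<le> (norm u)\<^sup>2"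
  by (simp add: idem_form idem_norm_le power_mono)

lemma idem_compl: "idem P \<Longrightarrow> idem (id_blinfun - P)"
  by (simp add: idem_def blinfun.diff_left blinfun.diff_right)

lemma idem_rank_one: "norm x = 1 \<Longrightarrow> idem (rank_one x)"
  by (simp add: idem_def cinner_simps cinner_self)

lemma idem_rank_one_add:
  assumes "norm x = 1" "norm y = 1" "cinner x y = 0"
  shows "idem (rank_one x + rank_one y)"
  using assms cinner_eq_0_commute[OF assms(3)]
  by (simp add: idem_def blinfun.add_left blinfun.add_right cinner_simps cinner_self)

text \<open>An extreme point of the ball of radius \<open>1 / 2\<close> in the quotient modulo
  scalars. The radius is the maximal deviation of a nontrivial projection, whose form has extreme
  values 0 and 1; \<open>max_deviation B = 0\<close> is the quotient version of
  \<open>B = 0\<close>.\<close>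

definition extremal :: "('a::complex_hilbert_space \<Rightarrow>\<^sub>L 'a) \<Rightarrow> bool"
  where "extremal A \<longleftrightarrow> max_deviation A = 1 / 2 \<and>
    (\<forall>B\<in>Bs. max_deviation (A + B) \<le> 1 / 2 \<and> max_deviation (A - B) \<le> 1 / 2 \<longrightarrow> max_deviation B = 0)"

text \<open>An orthonormal pair excludes dimensions zero and one. Beyond that, \<open>e0\<close>
  serves as the reference vector for centring operators and for building \<open>U\<close>.\<close>

locale nonscalar_space =
  fixes e0 f0 :: "'a::complex_hilbert_space"
  assumes e0: "norm e0 = 1" and f0: "norm f0 = 1" and e0f0: "cinner e0 f0 = 0"
begin

abbreviation m :: "('a \<Rightarrow>\<^sub>L 'a) \<Rightarrow> real" where "m \<equiv> max_deviation"

lemmas m_nonneg = max_deviation_nonneg[OF _ e0]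
  and m_le_form = max_deviation_le_form[OF _ e0]
  and m_triangle = max_deviation_triangle[OF _ _ e0]
  and m_scaleR = max_deviation_scaleR[OF _ e0]
  and m_cong = max_deviation_cong[OF _ _ _ e0]
  and m_scalar = max_deviation_scalar[OF e0]
  and m_zero_iff = max_deviation_zero_iff[OF _ e0]
  and m_eqv_iff = eqv_iff[OF _ _ e0]

lemma m_minus: "A \<in> Bs \<Longrightarrow> m (- A) = m A"
  using m_scaleR[of A "-1"] by simp

lemma m_form:
  assumes "A \<in> Bs" "norm u = 1" "norm v = 1"
  shows "inner (blinfun_apply A u) u - inner (A v) v \<le> 2 * m A"
proof -
  have "m A * sqrt (1 - (cmod (cinner u v))\<^sup>2) \<le> m A * 1"
    using m_nonneg[OF assms(1)] by (intro mult_left_mono) auto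
  then show ?thesis using max_deviation_form[OF assms] by linarith
qed

lemma m_le_range:
  assumes "A \<in> Bs" "a \<le> b" "\<And>u. norm u = 1 \<Longrightarrow> a \<le> inner (blinfun_apply A u) u"
    "\<And>u. norm u = 1 \<Longrightarrow> inner (A u) u \<le> b"
  shows "m A \<le> (b - a) / 2"
proof (rule m_le_form[OF assms(1)])
  fix u v :: 'a assume "norm u = 1" "norm v = 1"
  then show "inner (A u) u - inner (A v) v \<le> 2 * ((b - a) / 2)"
    using assms(4)[of u] assms(3)[of v] by simp
qed (use assms(2) in simp)

lemma perp_exists:
  assumes x: "norm (x::'a) = 1"
  obtains f where "norm f = 1" "cinner f x = 0"
proof -
  obtain w where w: "e0 = cinner e0 x *\<^sub>C x + w" "cinner w x = 0" using ortho_obtain[OF x] .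
  obtain z where z: "f0 = cinner f0 x *\<^sub>C x + z" "cinner z x = 0" using ortho_obtain[OF x] .
  have "w \<noteq> 0 \<or> z \<noteq> 0"
  proof (rule ccontr)
    assume "\<not> (w \<noteq> 0 \<or> z \<noteq> 0)"
    then have e: "e0 = cinner e0 x *\<^sub>C x" and f: "f0 = cinner f0 x *\<^sub>C x" using w(1) z(1) by auto
    have "cinner e0 f0 = cinner e0 x * cnj (cinner f0 x)"
      by (subst e, subst f) (simp add: cinner_simps cinner_self x)
    then have "cinner e0 x = 0 \<or> cinner f0 x = 0" using e0f0 by simp
    then have "e0 = 0 \<or> f0 = 0" using e f by auto
    then show False using e0 f0 by auto
  qed
  then obtain w where w: "w \<noteq> 0" "cinner w x = 0" using w(2) z(2) by blast
  then show thesis by (intro that[of "w /\<^sub>R norm w"]) (simp_all add: cinner_simps)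
qed

lemma extremal_cong:
  fixes A A' :: "'a \<Rightarrow>\<^sub>L 'a"
  assumes "A \<simeq> A'" "A \<in> Bs" "A' \<in> Bs"
  shows "extremal A \<longleftrightarrow> extremal A'"
proof -
  have "m (A + B) = m (A' + B)" "m (A - B) = m (A' - B)" if "B \<in> Bs" for B
    using that assms by (auto intro!: m_cong eqv_add eqv_diff)
  moreover have "m A = m A'" using assms m_cong by blast
  ultimately show ?thesis unfolding extremal_def by auto
qed

lemma idem_range:
  fixes P :: "'a \<Rightarrow>\<^sub>L 'a"
  assumes P: "idem P" "P \<noteq> 0"
  obtains e :: 'a where "norm e = 1" "P e = e"
proof -
  obtain v where v: "P v \<noteq> 0" using P(2) by (metis blinfun_eqI zero_blinfun.rep_eq)
  show thesis using v P(1)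
    by (intro that[of "P v /\<^sub>R norm (P v)"]) (simp_all add: blinfun.scaleR_right idem_def)
qed

lemma idem_kernel:
  fixes P :: "'a \<Rightarrow>\<^sub>L 'a"
  assumes P: "idem P" "P \<noteq> id_blinfun"
  obtains f :: 'a where "norm f = 1" "P f = 0"
proof -
  obtain f where "norm f = 1" "(id_blinfun - P) f = f"
    using idem_range[OF idem_compl[OF P(1)]] P(2) by auto
  then show thesis by (intro that[of f]) (simp_all add: blinfun.diff_left)
qed

text \<open>
  If \<open>0 \<le> T \<le> I\<close> with \<open>sup \<langle>Tu,u\<rangle> = 1\<close> then \<open>T\<close> is the midpoint of \<open>T\<^sup>2\<close> and
  \<open>2T - T\<^sup>2\<close>, both of which lie between \<open>0\<close> and \<open>I\<close>.
\<close>

lemma extremal_imp_idem: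
  fixes A :: "'a \<Rightarrow>\<^sub>L 'a"
  assumes A: "A \<in> Bs" and ext: "extremal A"
  obtains P where "idem P" "P \<noteq> 0" "P \<noteq> id_blinfun" "A \<simeq> P"
proof -
  have mA: "m A = 1 / 2" using ext by (simp add: extremal_def)
  define M where "M = (SUP u\<in>{u. norm u = 1}. inner (A u) u)"
  have "inner (A u) u \<le> norm A" if "norm u = 1" for u
    using norm_cauchy_schwarz[of "A u" u] norm_blinfun[of A u] that by simp
  then have "bdd_above ((\<lambda>u. inner (A u) u) ` {u. norm u = 1})"
    by (intro bdd_aboveI2) simp
  then have le_M: "inner (A u) u \<le> M" if "norm u = 1" for u
    unfolding M_def by (rule cSUP_upper2) (use that in auto)
  have M_le: "M \<le> b" if "\<And>u. norm u = 1 \<Longrightarrow> inner (A u) u \<le> b" for b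
    unfolding M_def by (rule cSUP_least) (use that e0 in auto)
  \<comment> \<open>The shift puts the top of the numerical range at 1; since its length is
    \<open>2 * m A = 1\<close>, this gives \<open>0 \<le> T \<le> I\<close>.\<close>
  define T where "T = A + (1 - M) *\<^sub>R id_blinfun"
  have T: "T \<in> Bs" using A by (simp add: T_def)
  have Tu: "inner (T u) u = inner (A u) u + (1 - M)" if "norm u = 1" for u
    using that by (simp add: T_def blinfun.add_left blinfun.scaleR_left inner_simps norm_eq_1)
  have T0: "0 \<le> inner (T u) u" if u: "norm u = 1" for u
    using M_le[of "1 + inner (A u) u"] m_form[OF A _ u] mA by (fastforce simp: Tu[OF u])
  have T1: "inner (T u) u \<le> 1" if "norm u = 1" for u using le_M[OF that] Tu[OF that] by simp
  have T0': "0 \<le> inner (T u) u" for u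
    using form_normalize[of u T] T0[of "u /\<^sub>R norm u"] by (cases "u = 0") auto
  have T1': "inner (T u) u \<le> (norm u)\<^sup>2" for u
  proof (cases "u = 0")
    case False
    then show ?thesis using T1[of "u /\<^sub>R norm u"]
      by (subst form_normalize[OF False], intro mult_left_le) auto
  qed simp
  have sq: "(norm (T u))\<^sup>2 \<le> inner (T u) u" for u
  proof (cases "T u = 0")
    case False
    have "((norm (T u))\<^sup>2)\<^sup>2 \<le> inner (T u) u * inner (T (T u)) (T u)"
      using psd_Cauchy_Schwarz[OF T T0', of u "T u"] by (simp add: power2_norm_eq_inner)
    also have "\<dots> \<le> inner (T u) u * (norm (T u))\<^sup>2" by (intro mult_left_mono T0' T1')
    finally show ?thesis using False by (simp add: power2_eq_square)
  qed (simp add: T0')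
  define B where "B = T - (T o\<^sub>L T)"
  have B: "B \<in> Bs" using T by (simp add: B_def Bs_square)
  have Bu: "inner (B u) u = inner (T u) u - (norm (T u))\<^sup>2" for u
    by (simp add: B_def blinfun.diff_left inner_simps power2_norm_eq_inner Bs_inner[OF T])
  have AT: "A \<simeq> T" unfolding T_def by (rule eqv_sym) simp
  have "m (T + B) \<le> (1 - 0) / 2"
  proof (rule m_le_range)
    fix u :: 'a assume u: "norm u = 1"
    have f: "inner ((T + B) u) u = 2 * inner (T u) u - (norm (T u))\<^sup>2"
      using Bu[of u] by (simp add: blinfun.add_left inner_simps)
    show "0 \<le> inner ((T + B) u) u" using f sq[of u] T0[OF u] by simp
    have "0 \<le> inner (u - T u) (u - T u)" by simp
    also have "\<dots> = 1 - 2 * inner (T u) u + (norm (T u))\<^sup>2"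
      using u by (simp add: inner_simps inner_commute power2_norm_eq_inner norm_eq_1)
    finally show "inner ((T + B) u) u \<le> 1" using f by simp
  qed (use T B in auto)
  moreover have "m (T - B) \<le> (1 - 0) / 2"
  proof (rule m_le_range)
    fix u :: 'a assume u: "norm u = 1"
    have f: "inner ((T - B) u) u = (norm (T u))\<^sup>2"
      using Bu[of u] by (simp add: blinfun.diff_left inner_simps)
    show "0 \<le> inner ((T - B) u) u" "inner ((T - B) u) u \<le> 1"
      using f sq[of u] T1[OF u] by auto
  qed (use T B in auto)
  moreover have "extremal T" using extremal_cong[OF AT A T] ext by simp
  ultimately have "m B = 0" using B by (simp add: extremal_def)
  then have "B \<simeq> 0" using m_zero_iff[OF B] by simp
  then obtain c where "\<And>x. B x = blinfun_apply 0 x + c *\<^sub>R x" using eqv_apply by blast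
  then have c: "B x = c *\<^sub>R x" for x by simp
  then have Bc: "inner (B u) u = c" if "norm u = 1" for u using that by (simp add: norm_eq_1)
  have "c \<ge> 0" using Bc[OF e0] Bu[of e0] sq[of e0] by simp
  \<comment> \<open>Extremality only makes \<open>B\<close> a scalar \<open>c \<ge> 0\<close>. From
    \<open>c \<le> t - t^2 \<le> 1 - t\<close> a positive \<open>c\<close> would keep the form of
    \<open>T\<close> away from its supremum 1.\<close>
  moreover have "inner (T u) u \<le> 1 - c" if u: "norm u = 1" for u
  proof -
    define t where "t = inner (T u) u"
    have t: "0 \<le> t" "t \<le> 1" using T0[OF u] T1[OF u] by (auto simp: t_def)
    have "t \<le> norm (T u)" using norm_cauchy_schwarz[of "T u" u] u by (simp add: t_def)
    then have "t\<^sup>2 \<le> (norm (T u))\<^sup>2" using t by (simp add: power_mono)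
    then have "c \<le> t - t\<^sup>2" using Bc[OF u] Bu[of u] by (simp add: t_def)
    moreover have "t - t\<^sup>2 \<le> 1 - t" using t mult_right_mono[of t 1 "1 - t"]
      by (simp add: power2_eq_square algebra_simps)
    ultimately show ?thesis by (simp add: t_def)
  qed
  then have "M \<le> M - c" using Tu by (intro M_le) fastforce
  ultimately have "c = 0" by simp
  then have "T (T x) = T x" for x using c[of x] by (simp add: B_def blinfun.diff_left)
  then have "idem T" using T by (simp add: idem_def)
  moreover have "T \<noteq> 0" "T \<noteq> id_blinfun"
    using m_cong[OF AT A T] mA m_scalar[of 0] m_scalar[of 1] by auto
  ultimately show thesis using AT that by blast
qed

lemma m_idem:
  assumes "idem P" "P \<noteq> 0" "P \<noteq> id_blinfun"
  shows "m P = 1 / 2"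
proof (rule antisym)
  have P: "P \<in> Bs" using assms by (simp add: idem_def)
  have "m P \<le> (1 - 0) / 2"
    using idem_form_le[OF assms(1)] idem_form[OF assms(1)]
    by (intro m_le_range P) (force, simp, metis one_power2)
  then show "m P \<le> 1 / 2" by simp
  obtain e where e: "norm e = 1" "P e = e" using idem_range assms by blast
  obtain f where f: "norm f = 1" "P f = 0" using idem_kernel assms by blast
  show "1 / 2 \<le> m P" using m_form[OF P e(1) f(1)] e f by (simp add: norm_eq_1)
qed

text \<open>Unit vectors from the range and the kernel of \<open>P\<close> already realise the full
  length 1 of the numerical range, so \<open>B\<close> must have the same form value
  \<open>b\<close> on all of them. Then \<open>C\<close> has form 1 on the range, 0 on the kernel
  and lies between 0 and \<open>I\<close>; by \<open>psd_zero\<close> these extreme values make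
  \<open>B\<close> equal to \<open>b\<close> on both subspaces.\<close>

lemma idem_imp_extremal:
  fixes P :: "'a \<Rightarrow>\<^sub>L 'a"
  assumes P: "idem P" "P \<noteq> 0" "P \<noteq> id_blinfun"
  shows "extremal P"
  unfolding extremal_def
proof (intro conjI ballI impI)
  show "m P = 1 / 2" using m_idem[OF P] .
  fix B :: "'a \<Rightarrow>\<^sub>L 'a" assume B: "B \<in> Bs" and le: "m (P + B) \<le> 1 / 2 \<and> m (P - B) \<le> 1 / 2"
  have PB: "P \<in> Bs" using P by (simp add: idem_def)
  obtain e where e: "norm e = 1" "P e = e" using idem_range P by blast
  obtain f where f: "norm f = 1" "P f = 0" using idem_kernel P by blast
  have eq: "inner (B x) x = inner (B y) y"
    if x: "norm x = 1" "P x = x" and y: "norm y = 1" "P y = 0" for x y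
    using m_form[of "P + B" x y] m_form[of "P - B" x y] PB B le x y
    by (simp add: blinfun.add_left blinfun.diff_left inner_simps norm_eq_1)
  define b where "b = inner (B f) f"
  define C where "C = P + B - b *\<^sub>R id_blinfun"
  have C: "C \<in> Bs" using PB B by (simp add: C_def)
  have Cx: "C x = P x + B x - b *\<^sub>R x" for x
    by (simp add: C_def blinfun.add_left blinfun.diff_left blinfun.scaleR_left)
  have b: "inner (B x) x = b" if "norm x = 1" "P x = x \<or> P x = 0" for x
    using that eq[of x f] eq[of e x] eq[of e f] e f b_def by auto
  have mC: "m C \<le> 1 / 2"
    using m_cong[of C "P + B"] eqv_add_scalar[of "P + B" "- b"] PB B C le by (simp add: C_def)
  have Ce: "inner (C x) x = 1" if "norm x = 1" "P x = x" for x
    using b[of x] that by (simp add: Cx inner_simps norm_eq_1)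
  have Cf: "inner (C x) x = 0" if "norm x = 1" "P x = 0" for x
    using b[of x] that by (simp add: Cx inner_simps norm_eq_1)
  have pos: "0 \<le> inner (C u) u" for u
  proof (cases "u = 0")
    case False
    have "0 \<le> inner (C (u /\<^sub>R norm u)) (u /\<^sub>R norm u)"
      using m_form[OF C e(1), of "u /\<^sub>R norm u"] mC Ce[OF e] False by simp
    then show ?thesis by (subst form_normalize[OF False]) simp
  qed simp
  have pos': "0 \<le> inner ((id_blinfun - C) u) u" for u
  proof (cases "u = 0")
    case False
    have "0 \<le> inner ((id_blinfun - C) v) v" if "norm v = 1" for v
      using m_form[OF C that f(1)] mC Cf[OF f] that
      by (simp add: blinfun.diff_left inner_simps norm_eq_1)
    from this[of "u /\<^sub>R norm u"] have "0 \<le> inner ((id_blinfun - C) (u /\<^sub>R norm u)) (u /\<^sub>R norm u)"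
      using False by simp
    then show ?thesis by (subst form_normalize[OF False]) simp
  qed simp
  have u1: "B x = b *\<^sub>R x" if "norm x = 1" "P x = x" for x
    using psd_zero[OF _ pos', of x] C Ce[OF that] that
    by (simp add: blinfun.diff_left inner_simps norm_eq_1 Cx)
  have "B (x /\<^sub>R norm x) = b *\<^sub>R (x /\<^sub>R norm x)" if "P x = x" "x \<noteq> 0" for x
    by (rule u1) (use that in \<open>simp_all add: blinfun.scaleR_right\<close>)
  then have 1: "B x = b *\<^sub>R x" if "P x = x" for x
    using that eigenvector_normalize[of x B b] by (cases "x = 0") auto
  have u2: "B x = b *\<^sub>R x" if "norm x = 1" "P x = 0" for x
    using psd_zero[OF C pos, of x] Cf[OF that] that by (simp add: Cx)
  have "B (x /\<^sub>R norm x) = b *\<^sub>R (x /\<^sub>R norm x)" if "P x = 0" "x \<noteq> 0" for x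
    by (rule u2) (use that in \<open>simp_all add: blinfun.scaleR_right\<close>)
  then have 2: "B x = b *\<^sub>R x" if "P x = 0" for x
    using that eigenvector_normalize[of x B b] by (cases "x = 0") auto
  have "B x = b *\<^sub>R x" for x
    using 1[of "P x"] 2[of "x - P x"] P(1) by (simp add: idem_def blinfun.diff_right algebra_simps)
  then have "B = b *\<^sub>R id_blinfun" by (intro blinfun_eqI) (simp add: blinfun.scaleR_left)
  then show "m B = 0" using m_scalar by simp
qed

section \<open>Projections at maximal distance and the rank-one class\<close>

lemma idem_sum_diff_le:
  assumes "idem P" "idem Q"
  shows "m (P - Q) \<le> 1" "m (P + Q) \<le> 1"
proof -
  have PQ: "P \<in> Bs" "Q \<in> Bs" using assms by (auto simp: idem_def)
  have f: "0 \<le> inner (P u) u" "0 \<le> inner (Q u) u" "inner (P u) u \<le> (norm u)\<^sup>2" "inner (Q u) u \<le> (norm u)\<^sup>2" for u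
    by (simp_all only: idem_form[OF assms(1)] idem_form[OF assms(2)] zero_le_power2)
      (use assms idem_norm_le in \<open>simp_all add: power_mono\<close>)
  have "m (P - Q) \<le> (1 - (-1)) / 2"
  proof (rule m_le_range)
    fix u :: 'a assume "norm u = 1"
    then show "- 1 \<le> inner ((P - Q) u) u" "inner ((P - Q) u) u \<le> 1"
      using f[of u] by (simp_all add: blinfun.diff_left inner_simps)
  qed (use PQ in auto)
  then show "m (P - Q) \<le> 1" by simp
  have "m (P + Q) \<le> (2 - 0) / 2"
  proof (rule m_le_range)
    fix u :: 'a assume "norm u = 1"
    then show "0 \<le> inner ((P + Q) u) u" "inner ((P + Q) u) u \<le> 2"
      using f[of u] by (simp_all add: blinfun.add_left inner_simps)
  qed (use PQ in auto)
  then show "m (P + Q) \<le> 1" by simp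
qed

text \<open>The supremum need not be attained in infinite dimension, so the argument is
  quantitative. A unit \<open>u\<close> whose form value is near 1 must be close to the line of
  \<open>x\<close>, where \<open>Q\<close> subtracts an amount controlled by
  \<open>q = norm (Q x)\<close>; this caps the form at \<open>1 - q^2 / 4\<close>.\<close>

lemma rank_one_far:
  assumes x: "norm x = 1" and Q: "idem Q" and far: "1 \<le> m (rank_one x - Q)"
  shows "Q x = 0"
proof -
  define q where "q = norm (Q x)"
  have QB: "Q \<in> Bs" using Q by (simp add: idem_def)
  have q: "0 \<le> q" "q \<le> 1" using idem_norm_le[OF Q, of x] x by (auto simp: q_def)
  then have q2: "q\<^sup>2 \<le> 1" by (simp add: power_le_one)
  have "m (rank_one x - Q) \<le> ((1 - q\<^sup>2 / 4) - (- 1)) / 2"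
  proof (rule m_le_range)
    fix u :: 'a assume u: "norm u = 1"
    define p r where "p = cmod (cinner u x)" and "r = norm (Q u)"
    obtain w where w: "u = cinner u x *\<^sub>C x + w" "cinner w x = 0" using ortho_obtain[OF x] .
    have form: "inner ((rank_one x - Q) u) u = p\<^sup>2 - r\<^sup>2"
      using inner_rank_one[of x u] idem_form[OF Q]
      by (simp add: blinfun.diff_left inner_simps p_def r_def del: rank_one_apply)
    have p: "p \<le> 1" "0 \<le> p" using cmod_cinner_le[of u x] u x by (auto simp: p_def)
    have r: "r \<le> 1" "0 \<le> r" using idem_norm_le[OF Q, of u] u by (auto simp: r_def)
    show "- 1 \<le> inner ((rank_one x - Q) u) u"
      using form r power_le_one[of r 2] zero_le_power2[of p] by linarith
    have "norm u ^ 2 = norm (cinner u x *\<^sub>C x) ^ 2 + norm w ^ 2"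
    proof -
      have "inner (cinner u x *\<^sub>C x) w = 0"
        using cinner_eq_0_commute[OF w(2)] by (simp add: inner_eq_Re_cinner cinner_simps)
      then show ?thesis
        unfolding power2_norm_eq_inner by (subst (1 2) w(1)) (simp add: inner_simps inner_commute)
    qed
    then have t: "(norm w)\<^sup>2 = 1 - p\<^sup>2" using u x by (simp add: p_def)
    have "p * q = norm (Q (cinner u x *\<^sub>C x))" by (simp add: Bs_scaleC[OF QB] p_def q_def)
    also have "\<dots> = norm (Q u - Q w)" by (subst (2) w(1)) (simp add: blinfun.add_right)
    also have "\<dots> \<le> r + norm w"
      using norm_triangle_ineq4[of "Q u" "Q w"] idem_norm_le[OF Q, of w] by (simp add: r_def)
    finally have "(p * q)\<^sup>2 \<le> (r + norm w)\<^sup>2" using p q by (simp add: power_mono)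
    also have "\<dots> \<le> 2 * r\<^sup>2 + 2 * (norm w)\<^sup>2"
      using zero_le_power2[of "r - norm w"] by (simp add: power2_eq_square algebra_simps)
    finally have pq: "p\<^sup>2 * q\<^sup>2 \<le> 2 * r\<^sup>2 + 2 * (1 - p\<^sup>2)" by (simp add: t power_mult_distrib)
    \<comment> \<open>For \<open>p^2 \<ge> 1 / 2\<close> the estimate just proved gives
      \<open>p^2 - r^2 \<le> 1 - p^2 * q^2 / 2\<close>. Otherwise \<open>p^2 < 1 / 2\<close> is
      already below \<open>3 / 4 \<le> 1 - q^2 / 4\<close>.\<close>
    have "p\<^sup>2 - r\<^sup>2 \<le> 1 - q\<^sup>2 / 4"
    proof (cases "p\<^sup>2 \<ge> 1 / 2")
      case True
      then have "1 / 2 * q\<^sup>2 \<le> p\<^sup>2 * q\<^sup>2" by (intro mult_right_mono) auto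
      then show ?thesis using pq by simp
    next
      case False
      then show ?thesis using q2 zero_le_power2[of r] by linarith
    qed
    then show "inner ((rank_one x - Q) u) u \<le> 1 - q\<^sup>2 / 4" using form by simp
  qed (use QB q2 in auto)
  with far have "1 \<le> ((1 - q\<^sup>2 / 4) - (- 1)) / 2" by (rule order_trans)
  then show ?thesis by (simp add: q_def)
qed

text \<open>Modulo scalars, adding \<open>Q\<close> is the same as subtracting the complementary
  projection, so this is \<open>rank_one_far\<close> for \<open>id_blinfun - Q\<close>.\<close>

lemma rank_one_near:
  assumes x: "norm x = 1" and Q: "idem Q" and far: "1 \<le> m (rank_one x + Q)"
  shows "Q x = x"
proof -
  have "rank_one x - (id_blinfun - Q) = (rank_one x + Q) + (-1) *\<^sub>R id_blinfun" by simp
  then have "m (rank_one x - (id_blinfun - Q)) = m (rank_one x + Q)"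
    using Q eqv_add_scalar[of "rank_one x + Q" "-1"] by (intro m_cong) (auto simp: idem_def algebra_simps)
  then have "(id_blinfun - Q) x = 0" using far by (intro rank_one_far x idem_compl Q) simp
  then show ?thesis by (simp add: blinfun.diff_left)
qed

lemma rank_one_nontrivial:
  assumes "norm (x::'a) = 1"
  shows "rank_one x \<noteq> 0" "rank_one x \<noteq> id_blinfun"
proof -
  show "rank_one x \<noteq> 0" using rank_one_unit[OF assms] assms by (metis norm_zero zero_blinfun.rep_eq zero_neq_one)
  obtain f where f: "norm f = 1" "cinner f x = 0" using perp_exists[OF assms] .
  then have "rank_one x f \<noteq> f" by auto
  then show "rank_one x \<noteq> id_blinfun" by (metis blinfun_apply_id_blinfun id_apply)
qed

lemma extremal_rank_one: "norm (x::'a) = 1 \<Longrightarrow> extremal (rank_one x)"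
  by (intro idem_imp_extremal idem_rank_one rank_one_nontrivial)

lemma m_minus_sum:
  assumes "A \<in> Bs" "B \<in> Bs"
  shows "m (- A + B) = m (A - B)" "m (- A - B) = m (A + B)"
  using m_minus[of "A - B"] m_minus[of "A + B"] assms by simp_all

lemma idem_not_rank_one:
  fixes P :: "'a \<Rightarrow>\<^sub>L 'a"
  assumes P: "idem P" "P \<noteq> 0" and nr: "\<And>x. norm x = 1 \<Longrightarrow> P \<noteq> rank_one x"
  obtains x y :: 'a where "norm x = 1" "norm y = 1" "cinner x y = 0" "P x = x" "P y = y"
proof -
  have PB: "P \<in> Bs" using P by (simp add: idem_def)
  obtain e where e: "norm e = 1" "P e = e" using idem_range P by blast
  obtain v where v: "P v \<noteq> rank_one e v" using nr[OF e(1)] by (metis blinfun_eqI)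
  define w where "w = P v - cinner (P v) e *\<^sub>C e"
  have "cinner (P v) e = cinner v e" using e by (simp add: Bs_cinner[OF PB])
  then have "w \<noteq> 0" using v by (simp add: w_def)
  moreover have "cinner w e = 0" using e by (simp add: w_def cinner_simps cinner_self)
  moreover have "P w = w" using P e by (simp add: w_def blinfun.diff_right Bs_scaleC[OF PB] idem_def)
  ultimately show thesis using e cinner_eq_0_commute[of w e]
    by (intro that[of e "w /\<^sub>R norm w"]) (simp_all add: cinner_simps blinfun.scaleR_right)
qed

text \<open>
  The class of operators \<open>\<plusminus>\<langle>\<cdot>,x\<rangle>x\<close> modulo scalars, described by maximal deviation alone: an
  idempotent whose range and kernel both have dimension at least two is at maximal distance
  from both \<open>Q\<close> and \<open>-Q\<close> for a suitable \<open>Q\<close> that splits its range and its kernel.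
\<close>

definition atomic :: "('a \<Rightarrow>\<^sub>L 'a) \<Rightarrow> bool"
  where "atomic A \<longleftrightarrow> extremal A \<and> \<not> (\<exists>Q\<in>Bs. extremal Q \<and> m (A - Q) = 1 \<and> m (A + Q) = 1)"

lemma atomic_cong:
  assumes "A \<simeq> A'" "A \<in> Bs" "A' \<in> Bs"
  shows "atomic A \<longleftrightarrow> atomic A'"
proof -
  have "m (A + B) = m (A' + B)" "m (A - B) = m (A' - B)" if "B \<in> Bs" for B
    using that assms by (auto intro!: m_cong eqv_add eqv_diff)
  then show ?thesis unfolding atomic_def extremal_cong[OF assms] by auto
qed

text \<open>Maximal distance from a projection forces it to kill \<open>x\<close>, maximal distance
  from its negative forces it to fix \<open>x\<close>; a unit vector cannot do both.\<close>

lemma atomic_rank_one: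
  assumes x: "norm x = 1"
  shows "atomic (rank_one x)"
  unfolding atomic_def
proof (intro conjI notI)
  show "extremal (rank_one x)" by (rule extremal_rank_one[OF x])
  assume "\<exists>Q\<in>Bs. extremal Q \<and> m (rank_one x - Q) = 1 \<and> m (rank_one x + Q) = 1"
  then obtain Q where Q: "Q \<in> Bs" "extremal Q" "m (rank_one x - Q) = 1" "m (rank_one x + Q) = 1" by blast
  obtain P where P: "idem P" "Q \<simeq> P" using extremal_imp_idem[OF Q(1,2)] by metis
  have PB: "P \<in> Bs" using P by (simp add: idem_def)
  have "m (rank_one x - P) = 1" "m (rank_one x + P) = 1"
    using Q P(2) PB m_cong[OF eqv_diff[OF eqv_refl P(2)]] m_cong[OF eqv_add[OF eqv_refl P(2)]]
    by (metis Bs_add Bs_diff Bs_rank_one)+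
  then have "P x = 0" "P x = x" using rank_one_far[OF x P(1)] rank_one_near[OF x P(1)] by auto
  then show False using x by auto
qed

lemma atomic_imp_rank_one:
  assumes A: "A \<in> Bs" and at: "atomic A"
  obtains x where "norm x = 1" "A \<simeq> rank_one x \<or> A \<simeq> - rank_one x"
proof -
  obtain P where P: "idem P" "P \<noteq> 0" "P \<noteq> id_blinfun" "A \<simeq> P"
    using extremal_imp_idem[OF A] at atomic_def by metis
  have PB: "P \<in> Bs" using P by (simp add: idem_def)
  have atP: "atomic P" using at atomic_cong[OF P(4) A PB] by simp
  show thesis
  proof (cases "\<exists>x. norm x = 1 \<and> (P = rank_one x \<or> id_blinfun - P = rank_one x)")
    case True
    then obtain x where x: "norm x = 1" "P = rank_one x \<or> id_blinfun - P = rank_one x" by blast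
    have "P \<simeq> - rank_one x" if "id_blinfun - P = rank_one x"
    proof -
      have "P = - rank_one x + 1 *\<^sub>R id_blinfun" using that by (simp add: algebra_simps)
      then show ?thesis using eqv_add_scalar by metis
    qed
    then show ?thesis using that x P(4) eqv_trans by metis
  next
    case False
    obtain x1 x2 where x: "norm x1 = 1" "norm x2 = 1" "cinner x1 x2 = 0" "P x1 = x1" "P x2 = x2"
      using idem_not_rank_one[OF P(1,2)] False by metis
    obtain y1 y2 where y: "norm y1 = 1" "norm y2 = 1" "cinner y1 y2 = 0"
      "(id_blinfun - P) y1 = y1" "(id_blinfun - P) y2 = y2"
      using idem_not_rank_one[OF idem_compl[OF P(1)]] P(3) False by (metis right_minus_eq)
    then have Py: "P y1 = 0" "P y2 = 0" by (simp_all add: blinfun.diff_left)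
    have xy: "cinner x y = 0" if "P x = x" "P y = 0" for x y
      using that Bs_cinner[OF PB, of x y] by simp
    \<comment> \<open>Half of the range pair and half of the kernel pair. Then \<open>P - Q\<close>
      takes the values 1 at \<open>x2\<close> and -1 at \<open>y1\<close>, and \<open>P + Q\<close>
      the values 2 at \<open>x1\<close> and 0 at \<open>y2\<close>, the largest spreads
      possible.\<close>
    define Q where "Q = rank_one x1 + rank_one y1"
    have Q: "idem Q" unfolding Q_def by (rule idem_rank_one_add) (use x y Py xy in auto)
    have QB: "Q \<in> Bs" by (simp add: Q_def)
    have Qv: "Q x1 = x1" "Q x2 = 0" "Q y1 = y1" "Q y2 = 0"
      using x y Py xy[of x1 y1] xy[of x1 y2] xy[of x2 y1] cinner_eq_0_commute[of x1 y1]
        cinner_eq_0_commute[of x1 y2] cinner_eq_0_commute[of x1 x2] cinner_eq_0_commute[of y1 y2]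
      by (simp_all add: Q_def blinfun.add_left cinner_self)
    have "Q \<noteq> 0" "Q \<noteq> id_blinfun" using Qv x by auto
    then have "extremal Q" using Q idem_imp_extremal by blast
    moreover have "m (P - Q) = 1"
      using idem_sum_diff_le(1)[OF P(1) Q] m_form[of "P - Q" x2 y1] PB QB x y Py Qv
      by (simp add: blinfun.diff_left norm_eq_1)
    moreover have "m (P + Q) = 1"
      using idem_sum_diff_le(2)[OF P(1) Q] m_form[of "P + Q" x1 y2] PB QB x y Py Qv
      by (simp add: blinfun.add_left norm_eq_1 inner_simps)
    ultimately show ?thesis using atP QB by (auto simp: atomic_def)
  qed
qed

text \<open>On the span of \<open>x\<close> and \<open>y\<close> the square of \<open>D\<close> is
  the scalar \<open>s\<close>, so \<open>D\<close> composed three times is \<open>s\<close> times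
  \<open>D\<close> and its norm is at most \<open>sqrt s\<close>. The form values \<open>s\<close>
  at \<open>x\<close> and \<open>- s\<close> at \<open>y\<close> give the matching lower bound
  through \<open>max_deviation_form\<close>. Thus the metric determines the transition
  probabilities, the data of Wigner's theorem.\<close>

lemma m_rank_one_diff:
  assumes x: "norm x = 1" and y: "norm y = 1"
  shows "(m (rank_one x - rank_one y))\<^sup>2 = 1 - (cmod (cinner x y))\<^sup>2"
proof -
  define g where "g = cinner x y"
  define D where "D = rank_one x - rank_one y"
  define s where "s = 1 - (cmod g)\<^sup>2"
  have D: "D \<in> Bs" by (simp add: D_def)
  have g1: "cmod g \<le> 1" using cmod_cinner_le[of x y] x y by (simp add: g_def)
  then have s0: "0 \<le> s" by (simp add: s_def power_le_one)
  have yx: "cinner y x = cnj g" by (metis g_def cinner_commute)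
  have gg: "g * cnj g = of_real (1 - s)" by (simp add: s_def complex_norm_square[symmetric])
  have scal: "z - (1 - of_real s) *\<^sub>C z = of_real s *\<^sub>C z" for z :: 'a
    using scaleC_add_left[of "1 - of_real s" "of_real s" z] by (simp add: algebra_simps)
  have D2: "D (D x) = s *\<^sub>R x" "D (D y) = s *\<^sub>R y"
    using gg by (simp_all add: D_def blinfun.diff_left blinfun.diff_right cinner_simps cinner_self x y
        scaleC_diff_right scaleC_scaleC yx g_def[symmetric] scaleR_scaleC mult.commute scal)
  have D3: "D (D (D u)) = s *\<^sub>R D u" for u
  proof -
    have Du: "D u = cinner u x *\<^sub>C x - cinner u y *\<^sub>C y" by (simp add: D_def blinfun.diff_left)
    show ?thesis
      unfolding Du by (simp add: blinfun.diff_right Bs_scaleC[OF D] D2 scaleC_scaleR scaleR_diff_right)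
  qed
  have nD: "norm (D u) \<le> sqrt s" if u: "norm u = 1" for u
  proof (cases "D u = 0")
    case False
    have "(norm (D u))\<^sup>2 = inner (D (D u)) u" by (simp add: power2_norm_eq_inner Bs_inner[OF D])
    also have "\<dots> \<le> norm (D (D u))" using norm_cauchy_schwarz[of "D (D u)" u] u by simp
    finally have "((norm (D u))\<^sup>2)\<^sup>2 \<le> (norm (D (D u)))\<^sup>2" by (intro power_mono) auto
    also have "\<dots> = inner (D (D (D u))) (D u)" by (simp add: power2_norm_eq_inner Bs_inner[OF D])
    also have "\<dots> = s * (norm (D u))\<^sup>2" by (simp add: D3 power2_norm_eq_inner)
    finally have "(norm (D u))\<^sup>2 \<le> s" using False by (simp add: power2_eq_square)
    then show ?thesis by (rule real_le_rsqrt)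
  qed (simp add: s0)
  have up: "m D \<le> sqrt s"
  proof (rule max_deviation_le[OF D e0])
    fix u v :: 'a assume "norm u = 1" "norm v = 1"
    then show "inner (D u) v \<le> sqrt s"
      using norm_cauchy_schwarz[of "D u" v] nD[of u] by simp
  qed (simp add: s0)
  have "inner (D x) x - inner (D y) y \<le> 2 * m D * sqrt s"
    using max_deviation_form[OF D x y] by (simp add: s_def g_def)
  moreover have "inner (D x) x = s" "inner (D y) y = - s"
  proof -
    have "inner (rank_one x x) x = 1" "inner (rank_one y y) y = 1"
      "inner (rank_one y x) x = (cmod g)\<^sup>2" "inner (rank_one x y) y = (cmod g)\<^sup>2"
      unfolding inner_rank_one using yx by (simp_all add: x y cinner_self g_def)
    then show "inner (D x) x = s" "inner (D y) y = - s"
      by (simp_all add: D_def blinfun.diff_left inner_diff_left s_def del: rank_one_apply)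
  qed
  ultimately have "sqrt s * sqrt s \<le> m D * sqrt s" using s0 by simp
  then have lo: "sqrt s \<le> m D"
    using s0 m_nonneg[OF D] mult_right_le_imp_le[of "sqrt s" "sqrt s" "m D"] by (cases "s = 0") auto
  show ?thesis using up lo s0 by (simp add: D_def[symmetric] s_def[symmetric] g_def[symmetric])
qed

end

subsection \<open>Linear isometries permute the rank-one projections up to sign\<close>

lemma cmod_cinner_commute: "cmod (cinner x y) = cmod (cinner y (x::'a::complex_hilbert_space))"
  using arg_cong[OF cinner_commute[of x y], of cmod] by simp

lemma cinner_unit_collinear:
  fixes x y :: "'a::complex_hilbert_space"
  assumes "norm x = 1" "norm y = 1" "cmod (cinner x y) = 1"
  shows "y = cinner y x *\<^sub>C x"
proof -
  define g where "g = cinner x y"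
  have yx: "cinner y x = cnj g" unfolding g_def by (rule cinner_commute)
  have "g * cnj g = 1"
    using complex_norm_square[of g] assms(3) by (simp add: g_def)
  then have "cinner (y - cnj g *\<^sub>C x) (y - cnj g *\<^sub>C x) = 0"
    using assms(1,2) by (simp add: cinner_simps cinner_self[of x] cinner_self[of y] yx g_def[symmetric] mult.commute)
  then have "y - cnj g *\<^sub>C x = 0" by (simp only: cinner_self) simp
  then show ?thesis unfolding yx by simp
qed

lemma idem_add_rank_one:
  assumes P: "idem P" and g: "norm g = 1" "P g = 0"
  shows "idem (P + rank_one g)"
proof -
  have PB: "P \<in> Bs" using P by (simp add: idem_def)
  have "cinner (P u) g = 0" for u by (simp add: Bs_cinner[OF PB] g)
  then show ?thesis
    using P g by (simp add: idem_def blinfun.add_left blinfun.add_right Bs_scaleC cinner_simps cinner_self)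
qed

text \<open>Surjectivity is demanded modulo scalars only, because the map built from
  \<open>\<phi>\<close> takes centred values; linearity, by contrast, holds exactly.\<close>

locale dev_isometry = nonscalar_space e0 f0
  for e0 f0 :: "'a::complex_hilbert_space" +
  fixes \<psi> :: "('a \<Rightarrow>\<^sub>L 'a) \<Rightarrow> ('a \<Rightarrow>\<^sub>L 'a)"
  assumes mem [simp]: "A \<in> Bs \<Longrightarrow> \<psi> A \<in> Bs"
    and add: "A \<in> Bs \<Longrightarrow> B \<in> Bs \<Longrightarrow> \<psi> (A + B) = \<psi> A + \<psi> B"
    and scl: "A \<in> Bs \<Longrightarrow> \<psi> (r *\<^sub>R A) = r *\<^sub>R \<psi> A"
    and dev: "A \<in> Bs \<Longrightarrow> m (\<psi> A) = m A"
    and surj: "B \<in> Bs \<Longrightarrow> \<exists>A\<in>Bs. \<psi> A \<simeq> B"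
begin

lemma minus: "A \<in> Bs \<Longrightarrow> \<psi> (- A) = - \<psi> A"
  using scl[of A "-1"] by simp

lemma diff: "A \<in> Bs \<Longrightarrow> B \<in> Bs \<Longrightarrow> \<psi> (A - B) = \<psi> A - \<psi> B"
  using add[of A "- B"] minus[of B] by simp

lemma eqv_image: "A \<in> Bs \<Longrightarrow> B \<in> Bs \<Longrightarrow> \<psi> A \<simeq> \<psi> B \<longleftrightarrow> A \<simeq> B"
  by (simp add: m_eqv_iff dev flip: diff)

lemma surjE:
  assumes "B \<in> Bs"
  obtains A where "A \<in> Bs" "\<psi> A \<simeq> B"
  using surj[OF assms] by blast

lemma m_image:
  assumes "A \<in> Bs" "C \<in> Bs" "B \<in> Bs" "\<psi> C \<simeq> B"
  shows "m (\<psi> A + B) = m (A + C)" "m (\<psi> A - B) = m (A - C)" "m B = m C"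
proof -
  have "m (\<psi> A + B) = m (\<psi> A + \<psi> C)" "m (\<psi> A - B) = m (\<psi> A - \<psi> C)" "m B = m (\<psi> C)"
    using assms by (auto intro!: m_cong eqv_add eqv_diff intro: eqv_sym)
  then show "m (\<psi> A + B) = m (A + C)" "m (\<psi> A - B) = m (A - C)" "m B = m C"
    using assms by (simp_all add: dev flip: add diff)
qed

lemma extremal_image:
  assumes A: "A \<in> Bs"
  shows "extremal (\<psi> A) \<longleftrightarrow> extremal A"
proof
  assume e: "extremal A"
  show "extremal (\<psi> A)"
    unfolding extremal_def
  proof (intro conjI ballI impI)
    show "m (\<psi> A) = 1 / 2" using e dev[OF A] by (simp add: extremal_def)
    fix B :: "'a \<Rightarrow>\<^sub>L 'a" assume B: "B \<in> Bs" and le: "m (\<psi> A + B) \<le> 1 / 2 \<and> m (\<psi> A - B) \<le> 1 / 2"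
    obtain C where C: "C \<in> Bs" "\<psi> C \<simeq> B" using surjE[OF B] .
    show "m B = 0" using e le C m_image[OF A C(1) B C(2)] by (simp add: extremal_def)
  qed
next
  assume e: "extremal (\<psi> A)"
  show "extremal A"
    unfolding extremal_def
  proof (intro conjI ballI impI)
    show "m A = 1 / 2" using e dev[OF A] by (simp add: extremal_def)
    fix C :: "'a \<Rightarrow>\<^sub>L 'a" assume C: "C \<in> Bs" and le: "m (A + C) \<le> 1 / 2 \<and> m (A - C) \<le> 1 / 2"
    show "m C = 0" using e le C m_image[OF A C mem[OF C] eqv_refl] mem[OF C]
      by (simp add: extremal_def)
  qed
qed

lemma atomic_image:
  assumes A: "A \<in> Bs"
  shows "atomic (\<psi> A) \<longleftrightarrow> atomic A"
proof -
  have "(\<exists>Q\<in>Bs. extremal Q \<and> m (\<psi> A - Q) = 1 \<and> m (\<psi> A + Q) = 1)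
    \<longleftrightarrow> (\<exists>Q\<in>Bs. extremal Q \<and> m (A - Q) = 1 \<and> m (A + Q) = 1)" (is "?l = ?r")
  proof
    assume ?l
    then obtain Q where Q: "Q \<in> Bs" "extremal Q" "m (\<psi> A - Q) = 1" "m (\<psi> A + Q) = 1" by blast
    obtain C where C: "C \<in> Bs" "\<psi> C \<simeq> Q" using surjE[OF Q(1)] .
    have "extremal C" using extremal_cong[OF C(2)] extremal_image[OF C(1)] C Q by simp
    then show ?r using C Q m_image[OF A C(1) Q(1) C(2)] by auto
  next
    assume ?r
    then obtain Q where Q: "Q \<in> Bs" "extremal Q" "m (A - Q) = 1" "m (A + Q) = 1" by blast
    have "m (\<psi> A + \<psi> Q) = 1" "m (\<psi> A - \<psi> Q) = 1"
      using m_image[OF A Q(1) mem[OF Q(1)] eqv_refl] Q by auto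
    then show ?l using Q extremal_image[OF Q(1)] mem[OF Q(1)] by blast
  qed
  then show ?thesis using extremal_image[OF A] by (simp add: atomic_def)
qed

lemma rank_one_image:
  assumes "norm (x::'a) = 1"
  obtains y where "norm y = 1" "\<psi> (rank_one x) \<simeq> rank_one y \<or> \<psi> (rank_one x) \<simeq> - rank_one y"
  using atomic_imp_rank_one[of "\<psi> (rank_one x)"] atomic_rank_one[OF assms] atomic_image[of "rank_one x"]
  by auto

text \<open>With opposite signs, \<open>rank_one x' + rank_one z'\<close> has deviation 1, and
  \<open>rank_one_near\<close> makes \<open>x'\<close> and \<open>z'\<close> collinear. Then
  \<open>- rank_one x \<simeq> rank_one z\<close>, which evaluation at \<open>t\<close> and at
  \<open>x\<close> refutes. The third direction \<open>t\<close> is essential: in dimension two that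
  relation is true.\<close>

lemma same_sign:
  assumes n: "norm x = 1" "norm z = 1" "norm t = 1" "norm x' = 1" "norm z' = 1"
    and o: "cinner x z = 0" "cinner t x = 0" "cinner t z = 0"
    and x: "\<psi> (rank_one x) \<simeq> - rank_one x'" and z: "\<psi> (rank_one z) \<simeq> rank_one z'"
  shows False
proof -
  have x': "\<psi> (- rank_one x) \<simeq> rank_one x'" using eqv_minus[OF x] by (simp add: minus)
  have "m (rank_one x' + rank_one z') = m (\<psi> (- rank_one x) + rank_one z')"
    using x' by (intro m_cong eqv_add) (auto intro: eqv_sym)
  also have "\<dots> = m (- rank_one x + rank_one z)" using m_image(1)[OF _ _ _ z] by simp
  also have "\<dots> = m (rank_one x - rank_one z)" by (simp only: m_minus_sum Bs_rank_one)
  also have "\<dots> = 1"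
  proof -
    have "(m (rank_one x - rank_one z))\<^sup>2 = 1" using m_rank_one_diff[OF n(1,2)] o by simp
    then show ?thesis using m_nonneg[of "rank_one x - rank_one z"] by (simp add: power2_eq_1_iff)
  qed
  finally have "rank_one z' x' = x'" using n by (intro rank_one_near idem_rank_one) auto
  then have c: "x' = cinner x' z' *\<^sub>C z'" by simp
  then have "cmod (cinner x' z') = 1" using n(4,5) by (metis mult.right_neutral norm_scaleC)
  then have "rank_one x' = rank_one z'" using rank_one_scaleC[of "cinner x' z'" z'] c by simp
  then have "\<psi> (- rank_one x) \<simeq> \<psi> (rank_one z)" using x' z eqv_sym eqv_trans by metis
  then have "- rank_one x \<simeq> rank_one z" by (simp add: eqv_image)
  then obtain c where c: "\<And>u. (- rank_one x) u = rank_one z u + c *\<^sub>R u" using eqv_apply by blast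
  have "c *\<^sub>R t = 0" using c[of t] o by (simp add: blinfun.minus_left)
  then have "c = 0" using n by auto
  then show False using c[of x] o n by (auto simp: blinfun.minus_left cinner_self)
qed

text \<open>If any two unit vectors have a common orthogonal unit vector, the signs at
  \<open>x\<close> and \<open>y\<close> are compared through one orthogonal to both. Otherwise the
  space is two-dimensional and each negative sign can be traded for a positive one by passing to the
  complementary line.\<close>

lemma uniform_sign:
  "(\<forall>x. norm x = 1 \<longrightarrow> (\<exists>y. norm y = 1 \<and> \<psi> (rank_one x) \<simeq> rank_one y)) \<or>
   (\<forall>x. norm x = 1 \<longrightarrow> (\<exists>y. norm y = 1 \<and> \<psi> (rank_one x) \<simeq> - rank_one y))"
proof (cases "\<forall>x y::'a. norm x = 1 \<longrightarrow> norm y = 1 \<longrightarrow> (\<exists>z. norm z = 1 \<and> cinner z x = 0 \<and> cinner z y = 0)")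
  case True
  show ?thesis
  proof (rule ccontr)
    assume "\<not> ?thesis"
    then obtain x y where x: "norm x = 1" "\<And>w. norm w = 1 \<Longrightarrow> \<not> \<psi> (rank_one x) \<simeq> rank_one w"
      and y: "norm y = 1" "\<And>w. norm w = 1 \<Longrightarrow> \<not> \<psi> (rank_one y) \<simeq> - rank_one w" by blast
    obtain x' where x': "norm x' = 1" "\<psi> (rank_one x) \<simeq> - rank_one x'"
      using rank_one_image[OF x(1)] x(2) by blast
    obtain y' where y': "norm y' = 1" "\<psi> (rank_one y) \<simeq> rank_one y'"
      using rank_one_image[OF y(1)] y(2) by blast
    obtain z where z: "norm z = 1" "cinner z x = 0" "cinner z y = 0" using True x(1) y(1) by blast
    obtain z' where z': "norm z' = 1" "\<psi> (rank_one z) \<simeq> rank_one z' \<or> \<psi> (rank_one z) \<simeq> - rank_one z'"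
      using rank_one_image[OF z(1)] by blast
    obtain s where s: "norm s = 1" "cinner s x = 0" "cinner s z = 0" using True x(1) z(1) by blast
    obtain t where t: "norm t = 1" "cinner t z = 0" "cinner t y = 0" using True z(1) y(1) by blast
    show False
      using z'(2) same_sign[OF x(1) z(1) s(1) x'(1) z'(1) cinner_eq_0_commute[OF z(2)] s(2,3) x'(2)]
        same_sign[OF z(1) y(1) t(1) z'(1) y'(1) z(3) t(2,3) _ y'(2)] by blast
  qed
next
  case False
  then obtain a y :: 'a where a: "norm a = 1" and y: "norm y = 1"
    and no: "\<And>z. norm z = 1 \<Longrightarrow> cinner z a = 0 \<Longrightarrow> cinner z y \<noteq> 0" by blast
  have no': "z = 0" if "cinner z a = 0" "cinner z y = 0" for z
    using no[of "z /\<^sub>R norm z"] that by (cases "z = 0") (auto simp: cinner_simps)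
  obtain w where w: "y = cinner y a *\<^sub>C a + w" "cinner w a = 0" using ortho_obtain[OF a] .
  obtain f where f: "norm f = 1" "cinner f a = 0" using perp_exists[OF a] .
  have "w \<noteq> 0"
  proof
    assume "w = 0"
    then have "cinner f y = 0" using f by (subst w(1)) (simp add: cinner_simps)
    then show False using no'[of f] f by auto
  qed
  define b where "b = w /\<^sub>R norm w"
  have b: "norm b = 1" "cinner b a = 0" "w = norm w *\<^sub>R b"
    using \<open>w \<noteq> 0\<close> w(2) by (simp_all add: b_def cinner_simps)
  have dec: "v = cinner v a *\<^sub>C a + cinner v b *\<^sub>C b" for v
  proof -
    define r where "r = v - cinner v a *\<^sub>C a - cinner v b *\<^sub>C b"
    have ra: "cinner r a = 0" "cinner r b = 0"
      using a b cinner_eq_0_commute[OF b(2)] by (simp_all add: r_def cinner_simps cinner_self)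
    then have "cinner r y = 0" by (subst w(1), subst b(3)) (simp add: cinner_simps)
    then have "r = 0" using no' ra by blast
    then show ?thesis by (simp add: r_def algebra_simps)
  qed
  have form: "(cmod (cinner v a))\<^sup>2 + (cmod (cinner v b))\<^sup>2 = 1" if "norm v = 1" for v
  proof -
    have "inner ((rank_one a + rank_one b) v) v = 1"
      using dec[of v] that by (simp add: blinfun.add_left norm_eq_1)
    then show ?thesis by (simp add: blinfun.add_left inner_add_left inner_rank_one del: rank_one_apply)
  qed
  have compl: "\<exists>w. norm w = 1 \<and> - rank_one x \<simeq> rank_one w" if x: "norm x = 1" for x :: 'a
  proof -
    obtain g where g: "norm g = 1" "cinner g x = 0" using perp_exists[OF x] .
    have gx: "cinner x g = 0" by (rule cinner_eq_0_commute[OF g(2)])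
    have "rank_one x v + rank_one g v = v" for v
    proof (rule ccontr)
      define r where "r = v - cinner v x *\<^sub>C x - cinner v g *\<^sub>C g"
      assume "rank_one x v + rank_one g v \<noteq> v"
      then have "r \<noteq> 0" by (auto simp: r_def algebra_simps)
      define h where "h = r /\<^sub>R norm r"
      have h: "norm h = 1" "cinner h x = 0" "cinner h g = 0"
        using \<open>r \<noteq> 0\<close> x g gx by (simp_all add: h_def r_def cinner_simps cinner_self)
      \<comment> \<open>A trace count in the basis \<open>a\<close>, \<open>b\<close>: three
        orthonormal vectors contribute 3 in total, but the form of a projection is at most 1 at each
        of \<open>a\<close> and \<open>b\<close>.\<close>
      have "idem (rank_one x + rank_one g + rank_one h)"
        using x g gx h by (intro idem_add_rank_one idem_rank_one) (simp_all add: blinfun.add_left)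
      then have "(cmod (cinner u x))\<^sup>2 + (cmod (cinner u g))\<^sup>2 + (cmod (cinner u h))\<^sup>2 \<le> (norm u)\<^sup>2" for u
        using idem_form_le[of _ u]
        by (fastforce simp add: blinfun.add_left inner_add_left inner_rank_one simp del: rank_one_apply)
      from this[of a] this[of b] form[OF x] form[OF g(1)] form[OF h(1)] a b(1) show False
        by (simp add: cmod_cinner_commute[of a] cmod_cinner_commute[of b])
    qed
    then have "rank_one x + rank_one g = id_blinfun"
      by (intro blinfun_eqI) (simp add: blinfun.add_left)
    then have "- rank_one x = rank_one g + (-1) *\<^sub>R id_blinfun" by (simp add: algebra_simps)
    then show ?thesis using g(1) eqv_add_scalar by metis
  qed
  have "\<exists>y. norm y = 1 \<and> \<psi> (rank_one x) \<simeq> rank_one y" if "norm x = 1" for x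
    using rank_one_image[OF that] compl eqv_trans by metis
  then show ?thesis by blast
qed

end

subsection \<open>Wigner's theorem for linear isometries\<close>

text \<open>The operator sending \<open>u\<close> to
  \<open>cinner u y *\<^sub>C x + cinner u x *\<^sub>C y\<close>, written as the polarisation of
  \<open>rank_one\<close> so that self-adjointness and images under linear maps are
  inherited.\<close>

definition sym_op :: "'a::complex_hilbert_space \<Rightarrow> 'a \<Rightarrow> ('a \<Rightarrow>\<^sub>L 'a)"
  where "sym_op x y = rank_one (x + y) - rank_one x - rank_one y"

lemma sym_op_apply: "sym_op x y u = cinner u y *\<^sub>C x + cinner u x *\<^sub>C y"
  by (simp add: sym_op_def blinfun.diff_left cinner_simps scaleC_add_left scaleC_add_right)

lemma Bs_sym_op [simp]: "sym_op x y \<in> Bs"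
  by (simp add: sym_op_def)

lemma sym_op_add: "sym_op x (y + z) = sym_op x y + sym_op x z"
  by (rule blinfun_eqI)
    (simp add: sym_op_apply blinfun.add_left cinner_simps scaleC_add_left scaleC_add_right)

lemma sym_op_scaleR:
  "sym_op x (r *\<^sub>R y) = r *\<^sub>R sym_op x y" "sym_op (r *\<^sub>R x) y = r *\<^sub>R sym_op x y"
  by (rule blinfun_eqI, simp add: sym_op_apply blinfun.scaleR_left cinner_simps scaleC_add_right
      scaleR_scaleC scaleC_scaleC mult.commute)+

lemma rank_one_add: "rank_one (x + y) = rank_one x + sym_op x y + rank_one y"
  by (simp add: sym_op_def)

lemma rank_one_diff: "rank_one (x - y) = rank_one x - sym_op x y + rank_one y"
  using rank_one_add[of x "- y"] sym_op_scaleR(1)[of x "-1" y] rank_one_scaleR[of "-1" y] by simp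

text \<open>Evaluation at \<open>e\<close> gives \<open>v = w + c *\<^sub>R e\<close>, and
  orthogonality to \<open>e\<close> removes \<open>c\<close>. Unlike \<open>rank_one\<close>, which
  forgets the phase, \<open>sym_op e\<close> retains the vector itself.\<close>

lemma sym_op_eqvD:
  assumes "sym_op e v \<simeq> sym_op e w" "norm e = 1" "cinner v e = 0" "cinner w e = 0"
  shows "v = w"
proof -
  obtain c where c: "\<And>u. sym_op e v u = sym_op e w u + c *\<^sub>R u" using eqv_apply[OF assms(1)] by blast
  have vw: "v = w + c *\<^sub>R e"
    using c[of e] assms by (simp add: sym_op_apply cinner_eq_0_commute cinner_self)
  then have "cinner v e = of_real c" using assms by (simp add: cinner_simps cinner_self)
  then show ?thesis using vw assms by simp
qed

lemma rank_one_eqD: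
  assumes "rank_one v = rank_one w"
  obtains c where "v = c *\<^sub>C w"
proof (cases "v = 0")
  case False
  have "cinner v v *\<^sub>C v = cinner v w *\<^sub>C w" using assms rank_one_apply by metis
  then have "inverse (cinner v v) *\<^sub>C cinner v v *\<^sub>C v = inverse (cinner v v) *\<^sub>C cinner v w *\<^sub>C w" by simp
  then show ?thesis using False that by (simp add: scaleC_scaleC cinner_self)
qed (use that[of 0] in simp)

locale pos_isometry = dev_isometry e0 f0 \<psi>
  for e0 f0 :: "'a::complex_hilbert_space" and \<psi> +
  assumes pos: "norm x = 1 \<Longrightarrow> \<exists>y. norm y = 1 \<and> \<psi> (rank_one x) \<simeq> rank_one y"
begin

section \<open>Transition probabilities and the isometry on the complement of
  \<open>e0\<close>\<close>

lemma cmod_image: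
  assumes n: "norm x = 1" "norm y = 1" "norm x' = 1" "norm y' = 1"
    and x: "\<psi> (rank_one x) \<simeq> rank_one x'" and y: "\<psi> (rank_one y) \<simeq> rank_one y'"
  shows "cmod (cinner x' y') = cmod (cinner x y)"
proof -
  have "m (rank_one x' - rank_one y') = m (\<psi> (rank_one x) - rank_one y')"
    using x by (intro m_cong eqv_diff) (auto intro: eqv_sym)
  also have "\<dots> = m (rank_one x - rank_one y)" using m_image(2)[OF _ _ _ y] by simp
  finally have "(cmod (cinner x' y'))\<^sup>2 = (cmod (cinner x y))\<^sup>2"
    using m_rank_one_diff n by (metis add_diff_cancel_left diff_add_cancel diff_diff_eq2)
  then show ?thesis by simp
qed

definition e1 :: 'a where "e1 = (SOME y. norm y = 1 \<and> \<psi> (rank_one e0) \<simeq> rank_one y)"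

lemma e1: "norm e1 = 1" "\<psi> (rank_one e0) \<simeq> rank_one e1"
  using someI_ex[OF pos[OF e0]] by (auto simp: e1_def)

text \<open>\<open>w\<close> is the intended image of a vector \<open>x\<close> orthogonal to
  \<open>e0\<close>. The \<open>sym_op\<close> clause pins \<open>w\<close> down, phase included;
  the \<open>rank_one\<close> clause is what later compares the images of \<open>x\<close> and of
  \<open>\<i>\<close> times \<open>x\<close>.\<close>

definition off :: "'a \<Rightarrow> 'a \<Rightarrow> bool"
  where "off x w \<longleftrightarrow> norm w = norm x \<and> cinner w e1 = 0 \<and>
    \<psi> (sym_op e0 x) \<simeq> sym_op e1 w \<and> \<psi> (rank_one x) \<simeq> rank_one w"

text \<open>Both \<open>sym_op e0 x\<close> and \<open>rank_one x\<close> are combinations of the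
  projections onto \<open>e0\<close> and onto the diagonals \<open>a\<close>, \<open>b\<close>. It
  remains to show that the images \<open>a1\<close>, \<open>b1\<close> are again diagonals
  \<open>e1 + w\<close>, \<open>e1 - w\<close>, scaled by \<open>r\<close>, with the same
  \<open>w\<close>.\<close>

lemma off_unit:
  assumes x: "norm x = 1" and o: "cinner x e0 = 0"
  shows "\<exists>w. off x w"
proof -
  define r where "r = inverse (sqrt 2)"
  have rr: "r * r = 1 / 2" by (simp add: r_def flip: inverse_mult_distrib)
  then have r2: "r\<^sup>2 = 1 / 2" by (simp add: power2_eq_square)
  have rs: "r * sqrt 2 = 1" by (simp add: r_def)
  have r0: "r > 0" by (simp add: r_def)
  have ox: "cinner e0 x = 0" by (rule cinner_eq_0_commute[OF o])
  define a b where "a = r *\<^sub>R (e0 + x)" and "b = r *\<^sub>R (e0 - x)"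
  have nn: "norm (e0 + x) = sqrt 2" "norm (e0 - x) = sqrt 2"
    using cinner_0_inner[OF o] cinner_0_inner[OF ox] x e0
    by (simp_all add: norm_eq_sqrt_inner inner_simps)
  have n: "norm a = 1" "norm b = 1" by (simp_all add: a_def b_def nn) (simp_all add: r_def)
  have ae: "cinner a e0 = r" "cinner b e0 = r" "cinner a b = 0"
    using o ox x e0 by (simp_all add: a_def b_def cinner_simps cinner_self)
  obtain a0 where a0: "norm a0 = 1" "\<psi> (rank_one a) \<simeq> rank_one a0" using pos[OF n(1)] by blast
  obtain b0 where b0: "norm b0 = 1" "\<psi> (rank_one b) \<simeq> rank_one b0" using pos[OF n(2)] by blast
  have ca: "cmod (cinner a0 e1) = r" "cmod (cinner b0 e1) = r"
    using cmod_image[OF n(1) e0 a0(1) e1(1) a0(2) e1(2)] cmod_image[OF n(2) e0 b0(1) e1(1) b0(2) e1(2)] ae r0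
    by simp_all
  \<comment> \<open>The image vectors are determined only up to phase; the phases are fixed so that
    both have the positive inner product \<open>r\<close> with \<open>e1\<close>.\<close>
  obtain c where c: "cmod c = 1" "c * cinner a0 e1 = r" using phase_obtain ca by metis
  obtain d where d: "cmod d = 1" "d * cinner b0 e1 = r" using phase_obtain ca by metis
  define a1 b1 where "a1 = c *\<^sub>C a0" and "b1 = d *\<^sub>C b0"
  have a1: "norm a1 = 1" "cinner a1 e1 = r" "\<psi> (rank_one a) \<simeq> rank_one a1"
    using a0 c by (simp_all add: a1_def cinner_simps rank_one_scaleC)
  have b1: "norm b1 = 1" "cinner b1 e1 = r" "\<psi> (rank_one b) \<simeq> rank_one b1"
    using b0 d by (simp_all add: b1_def cinner_simps rank_one_scaleC)
  have ab1: "cinner a1 b1 = 0"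
    using cmod_image[OF n(1) n(2) a1(1) b1(1) a1(3) b1(3)] ae by simp
  \<comment> \<open>Two candidates for the same vector, read off from \<open>a1\<close> and from
    \<open>b1\<close>. Orthogonality of \<open>a1\<close> and \<open>b1\<close> gives
    \<open>cinner w v = 1\<close>, so the two unit vectors coincide.\<close>
  define w v where "w = sqrt 2 *\<^sub>R a1 - e1" and "v = e1 - sqrt 2 *\<^sub>R b1"
  have sr: "complex_of_real (sqrt 2) * complex_of_real r = 1" by (simp add: r_def flip: of_real_mult)
  have s2: "complex_of_real (sqrt 2) * complex_of_real (sqrt 2) = 2" by (simp flip: of_real_mult)
  have ea: "cinner e1 a1 = r" "cinner e1 b1 = r" using a1(2) b1(2) by (metis cinner_commute complex_cnj_complex_of_real)+
  have we: "cinner w e1 = 0" "cinner v e1 = 0"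
    using a1 b1 e1 sr by (simp_all add: w_def v_def cinner_simps cinner_self)
  have "cinner w w = 1" "cinner v v = 1" "cinner w v = 1"
    using a1 b1 e1 sr ab1 s2 ea
    by (simp_all add: w_def v_def cinner_simps cinner_self[of a1] cinner_self[of b1] cinner_self[of e1]
        algebra_simps)
  then have nw: "norm w = 1" "norm v = 1" "cmod (cinner w v) = 1" "cinner v w = 1"
    using cinner_commute[of v w] by (simp_all add: norm_eq_sqrt_inner[of w] norm_eq_sqrt_inner[of v] inner_eq_Re_cinner)
  then have vw: "v = w" using cinner_unit_collinear[of w v] by simp
  have a1': "a1 = r *\<^sub>R (e1 + w)" "b1 = r *\<^sub>R (e1 - w)"
    by (simp add: w_def rs) (simp add: vw[symmetric] v_def rs)
  have "\<psi> (rank_one a - rank_one b) \<simeq> rank_one a1 - rank_one b1"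
    using eqv_diff[OF a1(3) b1(3)] by (simp add: diff)
  moreover have "rank_one (r *\<^sub>R (e + z)) - rank_one (r *\<^sub>R (e - z)) = sym_op e z" for e z :: 'a
    unfolding rank_one_scaleR rank_one_add rank_one_diff r2
    by (simp add: scaleR_add_right scaleR_diff_right flip: scaleR_add_left)
  ultimately have S: "\<psi> (sym_op e0 x) \<simeq> sym_op e1 w" unfolding a1' a_def b_def by simp
  have "\<psi> (rank_one a + rank_one b - rank_one e0) \<simeq> rank_one a1 + rank_one b1 - rank_one e1"
    using eqv_diff[OF eqv_add[OF a1(3) b1(3)] e1(2)] by (simp add: diff add)
  moreover have "rank_one (r *\<^sub>R (e + z)) + rank_one (r *\<^sub>R (e - z)) - rank_one e = rank_one z" for e z :: 'a
    unfolding rank_one_scaleR r2 scaleR_add_right[symmetric] rank_one_parallelogram by (simp add: scaleR_add_right)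
  ultimately have "\<psi> (rank_one x) \<simeq> rank_one w" unfolding a1' a_def b_def by simp
  then show ?thesis using S we nw x by (auto simp: off_def)
qed

lemma off_ex:
  assumes o: "cinner x e0 = 0"
  shows "\<exists>w. off x w"
proof (cases "x = 0")
  case True
  have "sym_op e 0 = 0" "rank_one (0::'a) = 0" for e :: 'a
    by (rule blinfun_eqI, simp add: sym_op_apply)+
  then have "off x 0" using True scl[of 0 0] by (simp add: off_def)
  then show ?thesis by blast
next
  case False
  define y where "y = x /\<^sub>R norm x"
  have y: "norm y = 1" "cinner y e0 = 0" "x = norm x *\<^sub>R y"
    using False o by (simp_all add: y_def cinner_simps)
  obtain w where w: "off y w" using off_unit[OF y(1,2)] by blast
  have "\<psi> (sym_op e0 (norm x *\<^sub>R y)) \<simeq> sym_op e1 (norm x *\<^sub>R w)"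
    "\<psi> (rank_one (norm x *\<^sub>R y)) \<simeq> rank_one (norm x *\<^sub>R w)"
    using w by (simp_all add: off_def sym_op_scaleR rank_one_scaleR scl eqv_scaleR)
  then have "off x (norm x *\<^sub>R w)"
    using w y by (simp add: off_def cinner_simps)
  then show ?thesis by blast
qed

definition W :: "'a \<Rightarrow> 'a" where "W x = (SOME w. off x w)"

lemma W: "cinner x e0 = 0 \<Longrightarrow> off x (W x)"
  unfolding W_def using off_ex by (rule someI_ex)

lemma W_norm: "cinner x e0 = 0 \<Longrightarrow> norm (W x) = norm x"
  and W_e1: "cinner x e0 = 0 \<Longrightarrow> cinner (W x) e1 = 0"
  and W_sym: "cinner x e0 = 0 \<Longrightarrow> \<psi> (sym_op e0 x) \<simeq> sym_op e1 (W x)"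
  and W_rank: "cinner x e0 = 0 \<Longrightarrow> \<psi> (rank_one x) \<simeq> rank_one (W x)"
  using W by (auto simp: off_def)

lemma W_unique:
  assumes "cinner x e0 = 0" "cinner w e1 = 0" "\<psi> (sym_op e0 x) \<simeq> sym_op e1 w"
  shows "W x = w"
  using sym_op_eqvD[of e1 "W x" w] eqv_trans[OF eqv_sym[OF W_sym[OF assms(1)]] assms(3)]
    W_e1[OF assms(1)] assms e1 by blast

lemma W_add:
  assumes "cinner x e0 = 0" "cinner y e0 = 0"
  shows "W (x + y) = W x + W y"
  using assms by (intro W_unique) (simp_all add: cinner_simps W_e1 sym_op_add add eqv_add W_sym)

lemma W_scaleR:
  assumes "cinner x e0 = 0"
  shows "W (r *\<^sub>R x) = r *\<^sub>R W x"
  using assms by (intro W_unique) (simp_all add: cinner_simps W_e1 sym_op_scaleR scl eqv_scaleR W_sym)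

lemma W_inner:
  assumes "cinner x e0 = 0" "cinner y e0 = 0"
  shows "inner (W x) (W y) = inner x y"
  using W_norm[of "x + y"] W_norm[OF assms(1)] W_norm[OF assms(2)] assms
  unfolding dot_norm by (simp add: W_add cinner_simps)

text \<open>\<open>rank_one\<close> does not see the factor \<open>\<i>\<close>, so the two images
  differ by a unimodular \<open>l\<close>, the stray scalar being removed by evaluation at
  \<open>e1\<close>. Since \<open>W\<close> preserves real inner products and \<open>\<i>\<close>
  times \<open>x\<close> is real-orthogonal to \<open>x\<close>, the real part of \<open>l\<close>
  is zero.\<close>

lemma W_i_cases:
  assumes x: "cinner x e0 = 0"
  shows "W (\<i> *\<^sub>C x) = \<i> *\<^sub>C W x \<or> W (\<i> *\<^sub>C x) = - (\<i> *\<^sub>C W x)"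
proof (cases "x = 0")
  case True
  then show ?thesis using W_scaleR[OF x, of 0] by simp
next
  case False
  have ix: "cinner (\<i> *\<^sub>C x) e0 = 0" using x by (simp add: cinner_simps)
  have "rank_one (W (\<i> *\<^sub>C x)) \<simeq> rank_one (W x)"
    using eqv_trans[OF eqv_sym[OF W_rank[OF ix]], of "rank_one (W x)"] W_rank[OF x]
    by (simp add: rank_one_scaleC)
  then obtain c where c: "\<And>u. rank_one (W (\<i> *\<^sub>C x)) u = rank_one (W x) u + c *\<^sub>R u"
    using eqv_apply by blast
  have "c *\<^sub>R e1 = 0"
    using c[of e1] cinner_eq_0_commute[OF W_e1[OF x]] cinner_eq_0_commute[OF W_e1[OF ix]] by simp
  then have "c = 0" using e1 by auto
  then have "rank_one (W (\<i> *\<^sub>C x)) = rank_one (W x)"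
    using c by (intro blinfun_eqI) (simp del: rank_one_apply)
  then obtain l where l: "W (\<i> *\<^sub>C x) = l *\<^sub>C W x" using rank_one_eqD by blast
  have "cmod l = 1"
    using W_norm[OF ix] W_norm[OF x] False by (simp add: l)
  moreover have "Re l = 0"
  proof -
    have "inner (\<i> *\<^sub>C x) x = 0" by (simp add: inner_eq_Re_cinner cinner_simps cinner_self)
    then have "inner (l *\<^sub>C W x) (W x) = 0" using W_inner[OF ix x] l by simp
    then have "Re l * (norm (W x))\<^sup>2 = 0" by (simp add: inner_eq_Re_cinner cinner_simps cinner_self)
    then show ?thesis using W_norm[OF x] False by simp
  qed
  ultimately have "\<bar>Im l\<bar> = 1" by (simp add: cmod_def)
  then have "l = \<i> \<or> l = - \<i>" using \<open>Re l = 0\<close> by (auto simp: complex_eq_iff abs_if split: if_splits)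
  then show ?thesis using l by auto
qed

text \<open>If the signs differed at nonzero \<open>x\<close> and \<open>y\<close>, additivity would
  contradict either choice of sign at \<open>x + y\<close>.\<close>

lemma W_i:
  "(\<forall>x. cinner x e0 = 0 \<longrightarrow> W (\<i> *\<^sub>C x) = \<i> *\<^sub>C W x) \<or>
   (\<forall>x. cinner x e0 = 0 \<longrightarrow> W (\<i> *\<^sub>C x) = - (\<i> *\<^sub>C W x))"
proof (rule ccontr)
  assume "\<not> ?thesis"
  then obtain x y where x: "cinner x e0 = 0" "W (\<i> *\<^sub>C x) \<noteq> \<i> *\<^sub>C W x"
    and y: "cinner y e0 = 0" "W (\<i> *\<^sub>C y) \<noteq> - (\<i> *\<^sub>C W y)" by blast
  have x': "W (\<i> *\<^sub>C x) = - (\<i> *\<^sub>C W x)" and y': "W (\<i> *\<^sub>C y) = \<i> *\<^sub>C W y"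
    using W_i_cases x y by blast+
  have "W (\<i> *\<^sub>C (x + y)) = - (\<i> *\<^sub>C W x) + \<i> *\<^sub>C W y"
    using x(1) y(1) x' y' by (simp add: scaleC_add_right W_add cinner_simps)
  moreover have "W (\<i> *\<^sub>C (x + y)) = \<i> *\<^sub>C (W x + W y) \<or> W (\<i> *\<^sub>C (x + y)) = - (\<i> *\<^sub>C (W x + W y))"
    using W_i_cases[of "x + y"] x(1) y(1) by (simp add: W_add cinner_simps)
  ultimately have "\<i> *\<^sub>C W x + \<i> *\<^sub>C W x = 0 \<or> \<i> *\<^sub>C W y + \<i> *\<^sub>C W y = 0"
    by (simp add: scaleC_add_right) (metis add.commute add.left_commute add_cancel_right_left ab_left_minus)
  then have "W x = 0 \<or> W y = 0"
    by (metis mult_1 norm_eq_zero norm_ii norm_scaleC scaleR_2 scaleR_eq_0_iff zero_neq_numeral)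
  then show False using x(2) x' y(2) y' by auto
qed

lemma W_conj:
  obtains \<sigma> where "\<sigma> = id \<or> \<sigma> = cnj" "\<And>c x. cinner x e0 = 0 \<Longrightarrow> W (c *\<^sub>C x) = \<sigma> c *\<^sub>C W x"
proof -
  have split: "c *\<^sub>C x = Re c *\<^sub>R x + Im c *\<^sub>R (\<i> *\<^sub>C x)" for c and x :: 'a
    by (simp add: scaleR_scaleC scaleC_scaleC mult.commute complex_eq[symmetric] flip: scaleC_add_left)
  have Ws: "W (c *\<^sub>C x) = Re c *\<^sub>R W x + Im c *\<^sub>R W (\<i> *\<^sub>C x)" if "cinner x e0 = 0" for c x
    using that by (subst split) (simp add: W_add W_scaleR cinner_simps)
  from W_i show thesis
  proof
    assume "\<forall>x. cinner x e0 = 0 \<longrightarrow> W (\<i> *\<^sub>C x) = \<i> *\<^sub>C W x"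
    then have "W (c *\<^sub>C x) = c *\<^sub>C W x" if "cinner x e0 = 0" for c x
      using that split[of c "W x"] Ws[OF that, of c] by simp
    then show thesis using that[of id] by simp
  next
    assume "\<forall>x. cinner x e0 = 0 \<longrightarrow> W (\<i> *\<^sub>C x) = - (\<i> *\<^sub>C W x)"
    then have "W (c *\<^sub>C x) = cnj c *\<^sub>C W x" if "cinner x e0 = 0" for c x
      using that split[of "cnj c" "W x"] Ws[OF that, of c] by simp
    then show thesis using that[of cnj] by simp
  qed
qed

text \<open>\<open>u\<close> sends \<open>e0\<close> to \<open>e1\<close> and acts as
  \<open>W\<close> on the complement; \<open>\<sigma>\<close> on the coefficient makes the two
  pieces homogeneous in the same way. The formula for \<open>rank_one\<close> follows by expanding
  it along \<open>e0\<close>, and surjectivity of \<open>u\<close> from that of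
  \<open>\<psi>\<close> on rank-one projections.\<close>

lemma implemented_on_rank_one:
  obtains U :: "'a \<Rightarrow>\<^sub>L 'a" where "unitary_op U \<or> antiunitary_op U"
    "\<And>z. \<psi> (rank_one z) \<simeq> rank_one (U z)"
proof -
  obtain \<sigma> where \<sigma>: "\<sigma> = id \<or> \<sigma> = cnj" and W\<sigma>: "\<And>c x. cinner x e0 = 0 \<Longrightarrow> W (c *\<^sub>C x) = \<sigma> c *\<^sub>C W x"
    using W_conj by blast
  have \<sigma>s: "\<sigma> (a + b) = \<sigma> a + \<sigma> b" "\<sigma> (a * b) = \<sigma> a * \<sigma> b" "\<sigma> (of_real r) = of_real r"
    "cmod (\<sigma> a) = cmod a" "\<sigma> (\<sigma> a) = a" for a b r
    using \<sigma> by auto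
  define p where "p z = z - cinner z e0 *\<^sub>C e0" for z
  have p: "cinner (p z) e0 = 0" for z using e0 by (simp add: p_def cinner_simps cinner_self)
  have p_add: "p (x + y) = p x + p y" for x y by (simp add: p_def cinner_simps scaleC_add_left)
  have p_scaleC: "p (c *\<^sub>C x) = c *\<^sub>C p x" for c x
    by (simp add: p_def cinner_simps scaleC_diff_right scaleC_scaleC)
  define u where "u z = \<sigma> (cinner z e0) *\<^sub>C e1 + W (p z)" for z
  have u_add: "u (x + y) = u x + u y" for x y
    by (simp add: u_def p_add W_add p cinner_simps \<sigma>s scaleC_add_left)
  have u_scaleC: "u (c *\<^sub>C x) = \<sigma> c *\<^sub>C u x" for c x
    by (simp add: u_def p_scaleC W\<sigma> p cinner_simps \<sigma>s scaleC_add_right scaleC_scaleC)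
  have pyth: "(norm (c *\<^sub>C e + x))\<^sup>2 = (cmod c)\<^sup>2 + (norm x)\<^sup>2" if "norm e = 1" "cinner x e = 0" for c and e x :: 'a
  proof -
    have "inner (c *\<^sub>C e) x = 0"
      using cinner_eq_0_commute[OF that(2)] by (simp add: inner_eq_Re_cinner cinner_simps)
    then have "(norm (c *\<^sub>C e + x))\<^sup>2 = (norm (c *\<^sub>C e))\<^sup>2 + (norm x)\<^sup>2"
      by (simp only: power2_norm_eq_inner) (simp add: inner_simps inner_commute)
    then show ?thesis using that by simp
  qed
  have u_norm: "norm (u z) = norm z" for z
  proof -
    have "(norm (u z))\<^sup>2 = (cmod (cinner z e0))\<^sup>2 + (norm (p z))\<^sup>2"
      unfolding u_def by (subst pyth) (simp_all add: e1 W_e1 p \<sigma>s W_norm)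
    also have "\<dots> = (norm (cinner z e0 *\<^sub>C e0 + p z))\<^sup>2" by (subst pyth) (simp_all add: e0 p)
    finally show ?thesis by (simp add: p_def)
  qed
  have bl: "bounded_linear u"
    by (rule bounded_linear_intro[where K = 1])
      (simp_all add: u_add u_norm scaleR_scaleC u_scaleC \<sigma>s del: norm_scaleC)
  define U where "U = Blinfun u"
  have U: "blinfun_apply U = u" using bl by (simp add: U_def bounded_linear_Blinfun_apply)
  have rank: "\<psi> (rank_one z) \<simeq> rank_one (u z)" for z
  proof -
    \<comment> \<open>The expansion along \<open>e0\<close> involves only real multiples of
      \<open>sym_op e0 x\<close>, so a phase first makes the coefficient of \<open>e0\<close>
      real.\<close>
    obtain g where g: "cmod g = 1" "g * cinner z e0 = of_real (cmod (cinner z e0))" using phase_obtain .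
    define r where "r = cmod (cinner z e0)"
    define x where "x = p (g *\<^sub>C z)"
    have x: "cinner x e0 = 0" by (simp add: x_def p)
    have gz: "g *\<^sub>C z = r *\<^sub>R e0 + x"
      using g by (simp add: x_def p_def cinner_simps r_def scaleR_scaleC)
    have ugz: "u (g *\<^sub>C z) = r *\<^sub>R e1 + W x"
      using g by (simp add: u_def x_def r_def scaleR_scaleC cinner_simps \<sigma>s)
    have R: "rank_one (r *\<^sub>R e + y) = r\<^sup>2 *\<^sub>R rank_one e + r *\<^sub>R sym_op e y + rank_one y" for e y :: 'a
      by (simp add: rank_one_add rank_one_scaleR sym_op_scaleR)
    have "\<psi> (rank_one (g *\<^sub>C z)) = r\<^sup>2 *\<^sub>R \<psi> (rank_one e0) + r *\<^sub>R \<psi> (sym_op e0 x) + \<psi> (rank_one x)"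
      unfolding gz R by (simp add: add scl)
    also have "\<dots> \<simeq> rank_one (r *\<^sub>R e1 + W x)"
      unfolding R by (intro eqv_add eqv_scaleR e1 W_sym W_rank x)
    also have "\<dots> = rank_one (\<sigma> g *\<^sub>C u z)" using ugz u_scaleC by simp
    finally show ?thesis using g by (simp add: rank_one_scaleC \<sigma>s)
  qed
  have hit: "\<exists>x. u x = y" if y: "norm y = 1" "norm x = 1" "cmod (cinner (u x) y) = 1" for x y
  proof -
    have "y = cinner y (u x) *\<^sub>C u x" using y u_norm by (intro cinner_unit_collinear) auto
    also have "\<dots> = u (\<sigma> (cinner y (u x)) *\<^sub>C x)" by (simp add: u_scaleC \<sigma>s)
    finally show ?thesis by metis
  qed
  have surj_unit: "\<exists>x. u x = y" if y: "norm y = 1" for y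
  proof -
    obtain A where A: "A \<in> Bs" "\<psi> A \<simeq> rank_one y" using surjE[of "rank_one y"] by auto
    have "atomic A"
      using atomic_image[OF A(1)] atomic_cong[OF A(2)] A atomic_rank_one[OF y] by simp
    then obtain x where x: "norm x = 1" "A \<simeq> rank_one x \<or> A \<simeq> - rank_one x"
      using atomic_imp_rank_one[OF A(1)] by blast
    have ux: "norm (u x) = 1" using x u_norm by simp
    from x(2) show ?thesis
    proof
      assume "A \<simeq> rank_one x"
      then have "\<psi> A \<simeq> \<psi> (rank_one x)" using A eqv_image by simp
      then have "\<psi> A \<simeq> rank_one (u x)" using rank by (rule eqv_trans)
      then have "rank_one (u x) \<simeq> rank_one y" by (rule eqv_trans[OF eqv_sym A(2)])
      then have "m (rank_one (u x) - rank_one y) = 0" by (simp add: m_eqv_iff)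
      then have "cmod (cinner (u x) y) = 1"
        using m_rank_one_diff[OF ux y] by (simp add: power2_eq_1_iff)
          (smt (verit) norm_ge_zero)
      then show ?thesis using hit y x by blast
    next
      \<comment> \<open>Possible in dimension two, so it has to be treated. There \<open>y\<close>
        spans the line of \<open>u f\<close> for \<open>f\<close> orthogonal to \<open>x\<close>:
        length and inner product with \<open>y\<close> in \<open>cf\<close>, together with
        \<open>c \<noteq> 0\<close>, give \<open>cmod (cinner (u f) y) = 1\<close>.\<close>
      assume "A \<simeq> - rank_one x"
      then have "\<psi> A \<simeq> \<psi> (- rank_one x)" using A eqv_image by simp
      then have "\<psi> A \<simeq> - rank_one (u x)"
        using eqv_trans[OF _ eqv_minus[OF rank[of x]]] by (simp add: minus)
      then have "- rank_one (u x) \<simeq> rank_one y" by (rule eqv_trans[OF eqv_sym A(2)])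
      then obtain c where "\<And>v. (- rank_one (u x)) v = rank_one y v + c *\<^sub>R v" using eqv_apply by blast
      then have "- (cinner v (u x) *\<^sub>C u x) = cinner v y *\<^sub>C y + c *\<^sub>R v" for v
        by (simp add: blinfun.minus_left)
      then have c: "cinner v (u x) *\<^sub>C u x + cinner v y *\<^sub>C y = (- c) *\<^sub>R v" for v
        by (simp only: neg_eq_iff_add_eq_0 scaleR_minus_left) (simp add: add.assoc eq_neg_iff_add_eq_0)
      obtain f where f: "norm f = 1" "cinner f x = 0" using perp_exists[OF x(1)] .
      have uf: "norm (u f) = 1" using f u_norm by simp
      have "cmod (cinner (u f) (u x)) = 0"
        using cmod_image[OF f(1) x(1) uf ux rank rank] f by simp
      then have cf: "cinner (u f) y *\<^sub>C y = (- c) *\<^sub>R u f" using c[of "u f"] by simp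
      then have "cinner (cinner (u f) y *\<^sub>C y) y = cinner ((- c) *\<^sub>R u f) y" by simp
      then have "cinner (u f) y = of_real (- c) * cinner (u f) y"
        using y by (simp only: cinner_simps cinner_self) simp
      then have "cmod (cinner (u f) y) = \<bar>c\<bar> * cmod (cinner (u f) y)"
        by (metis abs_minus_cancel norm_mult norm_of_real)
      moreover have "c \<noteq> 0"
      proof
        assume "c = 0"
        then have "cinner (cinner (u x) (u x) *\<^sub>C u x + cinner (u x) y *\<^sub>C y) (u x) = 0" using c[of "u x"] by simp
        then have "1 + cinner (u x) y * cinner y (u x) = 0"
          using ux by (simp add: cinner_simps cinner_self)
        moreover have "cinner (u x) y * cinner y (u x) = of_real ((cmod (cinner (u x) y))\<^sup>2)"
          by (metis cinner_commute complex_norm_square)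
        ultimately have "1 + complex_of_real ((cmod (cinner (u x) y))\<^sup>2) = 0" by simp
        then have "1 + (cmod (cinner (u x) y))\<^sup>2 = 0"
          by (metis of_real_1 of_real_add of_real_eq_0_iff)
        then show False by (smt (verit) zero_le_power2)
      qed
      moreover have "cmod (cinner (u f) y) = \<bar>c\<bar>"
        using arg_cong[OF cf, of norm] y uf by simp
      ultimately have "cmod (cinner (u f) y) = 1" by (metis abs_eq_0 mult_cancel_right1)
      then show ?thesis using hit y f by blast
    qed
  qed
  have "\<exists>x. u x = y" for y
  proof (cases "y = 0")
    case True
    then show ?thesis using u_norm[of 0] by auto
  next
    case False
    then obtain x where "u x = y /\<^sub>R norm y" using surj_unit[of "y /\<^sub>R norm y"] by auto
    then have "u (norm y *\<^sub>R x) = y" using False by (simp add: scaleR_scaleC u_scaleC \<sigma>s scaleC_scaleC)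
    then show ?thesis by blast
  qed
  then have "surj u" by (metis surjI)
  moreover have "inj u"
  proof (rule injI)
    fix x y assume "u x = u y"
    then have "norm (u (x - y)) = 0" using bl by (simp add: linear_diff bounded_linear.linear)
    then show "x = y" by (simp add: u_norm)
  qed
  ultimately have "bij u" by (simp add: bij_def)
  then have "unitary_op U \<or> antiunitary_op U"
    using \<sigma> by (auto simp: unitary_op_def antiunitary_op_def clinear_op_def antilinear_op_def U u_norm u_scaleC)
  then show thesis using that[of U] rank U by simp
qed

end

subsection \<open>From rank-one operators to all operators\<close>

lemma unitary_or_antiunitary:
  fixes U :: "'a::complex_hilbert_space \<Rightarrow>\<^sub>L 'a"
  assumes "unitary_op U \<or> antiunitary_op U"
  obtains \<sigma> where "\<sigma> = id \<or> \<sigma> = cnj" "\<And>c x. U (c *\<^sub>C x) = \<sigma> c *\<^sub>C U x"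
    "\<And>x y. cinner (U x) (U y) = \<sigma> (cinner x y)"
    "\<And>x. U (adjoint_op U x) = x" "\<And>x. adjoint_op U (U x) = x"
proof -
  obtain V where V: "is_adjoint_op U V" "U o\<^sub>L V = id_blinfun" "V o\<^sub>L U = id_blinfun"
    using isometry_adjoint[OF assms] .
  have a: "adjoint_op U = V" using V(1) by (rule adjoint_op_eqI)
  have UV: "U (V x) = x" and VU: "V (U x) = x" for x
    using arg_cong[OF V(2), of "\<lambda>T. blinfun_apply T x"] arg_cong[OF V(3), of "\<lambda>T. blinfun_apply T x"] by simp_all
  show thesis
  proof (cases "clinear_op U")
    case True
    then show ?thesis using V(1) UV VU
      by (intro that[of id]) (simp_all add: a is_adjoint_op_def clinear_op_def)
  next
    case False
    then have "antilinear_op U" using assms by (auto simp: unitary_op_def antiunitary_op_def)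
    then show ?thesis using V(1) UV VU False
      by (intro that[of cnj]) (simp_all add: a is_adjoint_op_def antilinear_op_def)
  qed
qed

text \<open>\<open>\<sigma>\<close> is the identity or conjugation, so one argument covers unitary
  and antiunitary \<open>U\<close>; \<open>V\<close> stands for the adjoint.\<close>

locale implementing =
  fixes U :: "'a::complex_hilbert_space \<Rightarrow>\<^sub>L 'a" and \<sigma> V
  assumes \<sigma>: "\<sigma> = id \<or> \<sigma> = cnj"
    and U_scaleC: "U (c *\<^sub>C x) = \<sigma> c *\<^sub>C U x"
    and U_cinner: "cinner (U x) (U y) = \<sigma> (cinner x y)"
    and UV [simp]: "U (blinfun_apply V x) = x" and VU [simp]: "V (U x) = x"
begin

definition T :: "('a \<Rightarrow>\<^sub>L 'a) \<Rightarrow> ('a \<Rightarrow>\<^sub>L 'a)"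
  where "T A = U o\<^sub>L A o\<^sub>L V"

lemma T_apply [simp]: "T A x = U (A (V x))"
  by (simp add: T_def)

lemma V_scaleC: "V (c *\<^sub>C x) = \<sigma> c *\<^sub>C V x"
proof -
  have "U (V (c *\<^sub>C x)) = U (\<sigma> c *\<^sub>C V x)" using \<sigma> by (auto simp: U_scaleC)
  then show ?thesis by (metis VU)
qed

lemma V_cinner: "cinner (V x) (V y) = \<sigma> (cinner x y)"
proof -
  have "\<sigma> (cinner (V x) (V y)) = cinner x y" using U_cinner[of "V x" "V y"] by simp
  from arg_cong[OF this, of \<sigma>] show ?thesis using \<sigma> by auto
qed

lemma T_Bs [simp]: "A \<in> Bs \<Longrightarrow> T A \<in> Bs"
proof (rule BsI)
  assume A: "A \<in> Bs"
  show "T A (c *\<^sub>C x) = c *\<^sub>C T A x" for c x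
    using \<sigma> by (auto simp: V_scaleC U_scaleC Bs_scaleC[OF A])
  show "cinner (T A x) y = cinner x (T A y)" for x y
    using U_cinner[of "A (V x)" "V y"] U_cinner[of "V x" "A (V y)"] by (simp add: Bs_cinner[OF A])
qed

lemma T_diff: "T (A - B) = T A - T B"
  and T_scaleR: "T (r *\<^sub>R A) = r *\<^sub>R T A"
  by (rule blinfun_eqI, simp add: blinfun.add_left blinfun.add_right blinfun.diff_left
      blinfun.diff_right blinfun.scaleR_left blinfun.scaleR_right)+

lemma T_rank_one: "T (rank_one x) = rank_one (U x)"
proof (rule blinfun_eqI)
  show "T (rank_one x) u = rank_one (U x) u" for u
    using U_cinner[of "V u" x] by (simp add: U_scaleC)
qed

end

text \<open>With \<open>P = rank_one x\<close> this \<open>B\<close> is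
  \<open>(I - P) A (I - P)\<close>. What is subtracted from \<open>A\<close> is a combination of
  rank-one operators, where the isometry is already known.\<close>

lemma Bs_kill:
  assumes A: "A \<in> Bs" and x: "norm x = 1"
  defines "B \<equiv> A - (sym_op x (A x) - inner (A x) x *\<^sub>R rank_one x)"
  shows "B \<in> Bs" "B x = 0" "A z = 0 \<Longrightarrow> cinner z x = 0 \<Longrightarrow> B z = 0"
proof -
  show "B \<in> Bs" using A by (simp add: B_def)
  have "cinner x (A x) = of_real (inner (A x) x)" using cinner_Bs_self[OF A, of x] Bs_cinner[OF A] by simp
  then show "B x = 0"
    using x by (simp add: B_def blinfun.diff_left blinfun.scaleR_left sym_op_apply cinner_self scaleR_scaleC)
  show "B z = 0" if "A z = 0" "cinner z x = 0"
    using that Bs_cinner[OF A, of z x]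
    by (simp add: B_def blinfun.diff_left blinfun.scaleR_left sym_op_apply)
qed

context pos_isometry
begin

text \<open>
  If \<open>A\<close> annihilates \<open>x\<close> and \<open>z\<close>, then for \<open>t \<ge> \<parallel>A\<parallel>\<close> the spectrum of
  \<open>A + t (P\<^sub>x - P\<^sub>z)\<close> lies in \<open>[-t, t]\<close> and the endpoints are attained at \<open>z\<close> and \<open>x\<close>.
  Comparing with the image under \<open>\<psi>\<close> pins down the diagonal of \<open>\<psi> A\<close> at \<open>U x\<close> and \<open>U z\<close>.
\<close>

lemma implemented:
  assumes "implementing U \<sigma> V" and U: "\<And>z. \<psi> (rank_one z) \<simeq> rank_one (U z)"
    and A: "A \<in> Bs"
  shows "\<psi> A \<simeq> U o\<^sub>L A o\<^sub>L V"
proof -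
  interpret implementing U \<sigma> V by fact
  have UT: "\<psi> (rank_one z) \<simeq> T (rank_one z)" for z using U by (simp add: T_rank_one)
  have UTs: "\<psi> (sym_op x y) \<simeq> T (sym_op x y)" for x y
    unfolding sym_op_def by (simp add: diff T_diff) (intro eqv_diff UT)
  have D: "\<psi> A - T A \<in> Bs" using A by simp
  \<comment> \<open>The bound 0 for the differences of diagonal values over all orthonormal pairs
    already makes \<open>\<psi> A - T A\<close> scalar.\<close>
  have "m (\<psi> A - T A) \<le> 0"
  proof (rule m_le_form[OF D])
    fix x' z' :: 'a assume n': "norm x' = 1" "norm z' = 1" "cinner x' z' = 0"
    define x z where "x = V x'" and "z = V z'"
    have Ux: "U x = x'" "U z = z'" by (simp_all add: x_def z_def)
    have Vn: "norm (V y) = norm y" for y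
      using V_cinner[of y y] \<sigma> by (auto simp: cinner_self simp flip: of_real_power)
    have n: "norm x = 1" "norm z = 1" "cinner x z = 0" "cinner z x = 0"
      using n' Vn V_cinner \<sigma> cinner_eq_0_commute[OF n'(3)] by (auto simp: x_def z_def)
    have step: "\<exists>B\<in>Bs. blinfun_apply B x = 0 \<and> (\<forall>z. blinfun_apply A z = 0 \<longrightarrow> cinner z x = 0 \<longrightarrow> B z = 0) \<and> \<psi> B - T B \<simeq> \<psi> A - T A"
      if A: "A \<in> Bs" and x: "norm x = 1" for A and x :: 'a
    proof -
      define C where "C = sym_op x (A x) - inner (A x) x *\<^sub>R rank_one x"
      have C: "C \<in> Bs" by (simp add: C_def)
      have "\<psi> C \<simeq> T C"
        by (simp add: C_def diff scl T_diff T_scaleR) (intro eqv_diff eqv_scaleR UT UTs)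
      then have "(\<psi> A - T A) - (\<psi> C - T C) \<simeq> (\<psi> A - T A) - (T C - T C)"
        by (intro eqv_diff eqv_refl)
      then have "\<psi> (A - C) - T (A - C) \<simeq> \<psi> A - T A"
        using A C by (simp add: diff T_diff algebra_simps)
      then show ?thesis using Bs_kill[OF A x] by (intro bexI[of _ "A - C"]) (auto simp: C_def)
    qed
    \<comment> \<open>\<open>z\<close> is killed first; killing \<open>x\<close> afterwards
      preserves this because \<open>z\<close> is orthogonal to \<open>x\<close>. Neither step
      changes the discrepancy between \<open>\<psi>\<close> and \<open>T\<close> modulo
      scalars.\<close>
    obtain A1 where A1: "A1 \<in> Bs" "A1 z = 0" "\<psi> A1 - T A1 \<simeq> \<psi> A - T A" using step[OF A n(2)] by blast
    obtain B where B: "B \<in> Bs" "B x = 0" "B z = 0" "\<psi> B - T B \<simeq> \<psi> A1 - T A1"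
      using step[OF A1(1) n(1)] A1(2) n(4) by blast
    have BA: "\<psi> B - T B \<simeq> \<psi> A - T A" by (rule eqv_trans[OF B(4) A1(3)])
    define t where "t = norm B"
    define C where "C = t *\<^sub>R (rank_one x - rank_one z)"
    define C' where "C' = t *\<^sub>R (rank_one x' - rank_one z')"
    have CB: "C \<in> Bs" "C' \<in> Bs" by (simp_all add: C_def C'_def)
    have CC: "\<psi> C \<simeq> C'"
      unfolding C_def C'_def by (simp add: scl diff) (use U[of x] U[of z] Ux in \<open>auto intro!: eqv_scaleR eqv_diff\<close>)
    have t: "0 \<le> t" by (simp add: t_def)
    have "m (B + C) \<le> (t - (- t)) / 2"
    proof (rule m_le_range)
      fix u :: 'a assume u: "norm u = 1"
      define a b where "a = (cmod (cinner u x))\<^sup>2" and "b = (cmod (cinner u z))\<^sup>2"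
      define P where "P = rank_one x + rank_one z"
      define w where "w = (id_blinfun - P) u"
      have P: "idem P" unfolding P_def by (rule idem_rank_one_add) (use n in auto)
      have "(norm w)\<^sup>2 = inner ((id_blinfun - P) u) u"
        unfolding w_def by (rule idem_form[OF idem_compl[OF P], symmetric])
      also have "\<dots> = 1 - a - b"
        using u inner_rank_one[of x u] inner_rank_one[of z u]
        by (simp add: P_def blinfun.diff_left blinfun.add_left inner_diff_left inner_add_left norm_eq_1
            a_def b_def del: rank_one_apply)
      finally have w: "(norm w)\<^sup>2 = 1 - a - b" .
      have Bw: "B w = B u"
        using B by (simp add: w_def P_def blinfun.diff_left blinfun.diff_right blinfun.add_left
            blinfun.add_right Bs_scaleC)
      have "inner (B u) u = inner (B w) w" by (metis Bw Bs_inner[OF B(1)])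
      moreover have "\<bar>inner (B w) w\<bar> \<le> t * (norm w)\<^sup>2"
        using Cauchy_Schwarz_ineq2[of "B w" w] mult_right_mono[OF norm_blinfun[of B w], of "norm w"]
        by (simp add: t_def power2_eq_square mult.assoc)
      ultimately have 1: "\<bar>inner (B u) u\<bar> \<le> t - t * a - t * b" using w by (simp add: algebra_simps)
      have 2: "inner ((B + C) u) u = inner (B u) u + t * a - t * b"
        using inner_rank_one[of x u] inner_rank_one[of z u]
        by (simp add: C_def blinfun.add_left blinfun.scaleR_left blinfun.diff_left inner_add_left
            inner_diff_left a_def b_def algebra_simps del: rank_one_apply)
      have "0 \<le> t * a" "0 \<le> t * b" using t by (simp_all add: a_def b_def)
      then show "- t \<le> inner ((B + C) u) u" "inner ((B + C) u) u \<le> t"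
        using 1 2 by linarith+
    qed (use t B(1) CB in auto)
    then have "m (\<psi> B + C') \<le> t" using m_image(1)[OF B(1) CB CC] by simp
    then have "inner ((\<psi> B + C') x') x' - inner ((\<psi> B + C') z') z' \<le> 2 * t"
      using m_form[of "\<psi> B + C'" x' z'] B CB n' by simp
    moreover have "C' x' = t *\<^sub>R x'" "C' z' = - (t *\<^sub>R z')"
      using n' cinner_eq_0_commute[OF n'(3)]
      by (simp_all add: C'_def blinfun.scaleR_left blinfun.diff_left cinner_self)
    ultimately have "inner (\<psi> B x') x' - inner (\<psi> B z') z' \<le> 0"
      using n' by (simp add: blinfun.add_left inner_add_left inner_diff_left norm_eq_1)
    moreover have "T B x' = 0" "T B z' = 0"
      using B(2,3) by (simp_all add: x_def[symmetric] z_def[symmetric])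
    ultimately have "inner ((\<psi> B - T B) x') x' - inner ((\<psi> B - T B) z') z' \<le> 0"
      by (simp add: blinfun.diff_left del: T_apply)
    moreover obtain c where "\<And>u. (\<psi> B - T B) u = (\<psi> A - T A) u + c *\<^sub>R u" using eqv_apply[OF BA] by blast
    ultimately show "inner ((\<psi> A - T A) x') x' - inner ((\<psi> A - T A) z') z' \<le> 2 * 0"
      using n' by (simp add: inner_add_left norm_eq_1 del: T_apply)
  qed simp
  then have "m (\<psi> A - T A) = 0" using m_nonneg[OF D] by simp
  then show ?thesis using A by (simp add: m_eqv_iff T_def[symmetric])
qed

lemma classification:
  obtains U where "unitary_op U \<or> antiunitary_op U"
    "\<And>A. A \<in> Bs \<Longrightarrow> \<psi> A \<simeq> U o\<^sub>L A o\<^sub>L adjoint_op U"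
proof -
  obtain U :: "'a \<Rightarrow>\<^sub>L 'a" where U: "unitary_op U \<or> antiunitary_op U"
    "\<And>z. \<psi> (rank_one z) \<simeq> rank_one (U z)"
    using implemented_on_rank_one by blast
  obtain \<sigma> where "implementing U \<sigma> (adjoint_op U)"
    using unitary_or_antiunitary[OF U(1)] unfolding implementing_def by metis
  then show thesis using that[OF U(1)] implemented[OF _ U(2)] by blast
qed

end

section \<open>Linearising the given bijection by centring\<close>

context nonscalar_space
begin

text \<open>A linear choice of representative, the one whose form vanishes at \<open>e0\<close>. It
  turns \<open>\<simeq>\<close> into equality, hence maps that are additive up to scalars into
  additive ones.\<close>

definition centered :: "('a \<Rightarrow>\<^sub>L 'a) \<Rightarrow> ('a \<Rightarrow>\<^sub>L 'a)"
  where "centered A = A - inner (A e0) e0 *\<^sub>R id_blinfun"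

lemma centered_Bs [simp]: "A \<in> Bs \<Longrightarrow> centered A \<in> Bs"
  by (simp add: centered_def)

lemma centered_eqv: "centered A \<simeq> A"
  using eqv_add_scalar[of A "- inner (A e0) e0"] by (simp add: centered_def)

lemma centered_cong: "A \<simeq> B \<Longrightarrow> centered A = centered B"
  using e0 by (auto simp: eq_mod_scalar_def centered_def blinfun.add_left blinfun.scaleR_left
      inner_add_left norm_eq_1 algebra_simps)

lemma centered_add: "centered (A + B) = centered A + centered B"
  by (simp add: centered_def blinfun.add_left inner_add_left algebra_simps)

lemma centered_scaleR: "centered (r *\<^sub>R A) = r *\<^sub>R centered A"
  by (simp add: centered_def blinfun.scaleR_left scaleR_diff_right)

lemma seminorm_on_m: "seminorm_on Bs m"
  by unfold_locales (auto simp: subspace_Bs m_triangle m_scaleR)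

text \<open>
  Homogeneity follows from additivity because \<open>n \<psi>(rA)\<close> and \<open>nr \<psi>(A)\<close> both differ from
  \<open>\<lfloor>nr\<rfloor> \<psi>(A)\<close> by at most the maximal deviation of \<open>A\<close>, for every \<open>n\<close>.
\<close>

lemma dev_isometry_centered:
  fixes \<phi> :: "('a \<Rightarrow>\<^sub>L 'a) \<Rightarrow> ('a \<Rightarrow>\<^sub>L 'a)"
  assumes bij: "bij_betw \<phi> Bs Bs"
    and iso: "\<And>A B. A \<in> Bs \<Longrightarrow> B \<in> Bs \<Longrightarrow> m (\<phi> A - \<phi> B) = m (A - B)"
  defines "\<psi> \<equiv> \<lambda>A. centered (\<phi> A - \<phi> 0)"
  shows "dev_isometry e0 f0 \<psi>"
proof -
  interpret S: seminorm_on Bs m by (rule seminorm_on_m)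
  have \<phi>: "\<phi> A \<in> Bs" if "A \<in> Bs" for A using bij that by (rule bij_betw_apply)
  have isom: "S.isom \<phi>" using bij iso by (simp add: S.isom_def)
  have mem: "\<psi> A \<in> Bs" if "A \<in> Bs" for A using \<phi> that by (simp add: \<psi>_def)
  have zero: "\<psi> 0 = 0" by (simp add: \<psi>_def centered_def)
  \<comment> \<open>The seminorm version of the midpoint theorem leaves an unknown scalar; centring
    removes it.\<close>
  have half: "\<psi> ((1/2) *\<^sub>R (A + B)) = (1/2) *\<^sub>R (\<psi> A + \<psi> B)" if AB: "A \<in> Bs" "B \<in> Bs" for A B
  proof -
    have "\<phi> ((1/2) *\<^sub>R (A + B)) \<simeq> (1/2) *\<^sub>R (\<phi> A + \<phi> B)"
      using S.isom_midpoint[OF isom AB] AB \<phi> by (simp add: m_eqv_iff)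
    then have "\<phi> ((1/2) *\<^sub>R (A + B)) - \<phi> 0 \<simeq> (1/2) *\<^sub>R (\<phi> A + \<phi> B) - \<phi> 0"
      by (intro eqv_diff eqv_refl)
    also have "(1/2) *\<^sub>R (\<phi> A + \<phi> B) - \<phi> 0 = (1/2) *\<^sub>R ((\<phi> A - \<phi> 0) + (\<phi> B - \<phi> 0))"
    proof -
      have "(1/2) *\<^sub>R ((\<phi> A - \<phi> 0) + (\<phi> B - \<phi> 0))
          = (1/2) *\<^sub>R (\<phi> A + \<phi> B) - ((1/2) *\<^sub>R \<phi> 0 + (1/2) *\<^sub>R \<phi> 0)"
        by (simp add: scaleR_add_right scaleR_diff_right)
      also have "(1/2) *\<^sub>R \<phi> 0 + (1/2) *\<^sub>R \<phi> 0 = \<phi> 0" by (simp flip: scaleR_add_left)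
      finally show ?thesis ..
    qed
    finally show ?thesis by (simp add: \<psi>_def centered_add centered_scaleR centered_cong)
  qed
  have half1: "\<psi> ((1/2) *\<^sub>R A) = (1/2) *\<^sub>R \<psi> A" if "A \<in> Bs" for A
    using half[OF that Bs_zero] by (simp add: zero)
  have add: "\<psi> (A + B) = \<psi> A + \<psi> B" if AB: "A \<in> Bs" "B \<in> Bs" for A B
  proof -
    have "\<psi> (A + B) = \<psi> ((1/2) *\<^sub>R (2 *\<^sub>R A + 2 *\<^sub>R B))" by (simp add: scaleR_add_right)
    also have "\<dots> = (1/2) *\<^sub>R \<psi> (2 *\<^sub>R A) + (1/2) *\<^sub>R \<psi> (2 *\<^sub>R B)"
      using AB by (subst half) (simp_all add: scaleR_add_right)
    also have "\<dots> = \<psi> A + \<psi> B"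
      using half1[of "2 *\<^sub>R A"] half1[of "2 *\<^sub>R B"] AB by simp
    finally show ?thesis .
  qed
  have dev: "m (\<psi> A) = m A" if "A \<in> Bs" for A
    using m_cong[OF centered_eqv[of "\<phi> A - \<phi> 0"]] iso[OF that Bs_zero] \<phi> that by (simp add: \<psi>_def)
  have nat: "\<psi> (real n *\<^sub>R A) = real n *\<^sub>R \<psi> A" if A: "A \<in> Bs" for A n
    by (induction n) (simp_all add: zero add A scaleR_add_left)
  have neg: "\<psi> (- A) = - \<psi> A" if "A \<in> Bs" for A
    using add[of A "- A"] that by (simp add: zero eq_neg_iff_add_eq_0 add.commute)
  have int: "\<psi> (real_of_int k *\<^sub>R A) = real_of_int k *\<^sub>R \<psi> A" if A: "A \<in> Bs" for A k
  proof (cases "k \<ge> 0")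
    case True
    then show ?thesis using nat[OF A, of "nat k"] by simp
  next
    case False
    then show ?thesis using nat[OF A, of "nat (- k)"] neg[of "real_of_int (- k) *\<^sub>R A"] A by simp
  qed
  have scl: "\<psi> (r *\<^sub>R A) = r *\<^sub>R \<psi> A" if A: "A \<in> Bs" for r A
  proof -
    define E where "E = \<psi> (r *\<^sub>R A) - r *\<^sub>R \<psi> A"
    have E: "E \<in> Bs" using A mem by (simp add: E_def)
    have bound: "real n * m E \<le> 2 * m A" for n
    proof -
      define k where "k = \<lfloor>real n * r\<rfloor>"
      define d where "d = real n * r - k"
      have d: "\<bar>d\<bar> \<le> 1" unfolding d_def k_def by linarith
      have nr: "real n * r = k + d" by (simp add: d_def)
      have "real n *\<^sub>R E = \<psi> ((real n * r) *\<^sub>R A) - (real n * r) *\<^sub>R \<psi> A"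
        using nat[of "r *\<^sub>R A" n] A by (simp add: E_def scaleR_diff_right)
      also have "\<dots> = \<psi> (d *\<^sub>R A) + (- d) *\<^sub>R \<psi> A"
        using A by (simp add: nr scaleR_add_left add int)
      finally have "m (real n *\<^sub>R E) \<le> m (\<psi> (d *\<^sub>R A)) + m ((- d) *\<^sub>R \<psi> A)"
        using m_triangle[of "\<psi> (d *\<^sub>R A)" "(- d) *\<^sub>R \<psi> A"] A mem by simp
      also have "\<dots> = 2 * (\<bar>d\<bar> * m A)"
        using A mem[OF A] dev[of "d *\<^sub>R A"] dev[OF A] m_scaleR[OF A, of d]
          m_scaleR[OF mem[OF A], of "- d"] by simp
      also have "\<dots> \<le> 2 * m A" using mult_right_mono[OF d m_nonneg[OF A]] by simp
      finally show ?thesis using E by (simp add: m_scaleR)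
    qed
    have "m E = 0"
    proof (rule ccontr)
      assume "m E \<noteq> 0"
      then have "m E > 0" using m_nonneg[OF E] by simp
      then obtain n where "2 * m A < real n * m E" using reals_Archimedean3 by blast
      then show False using bound[of n] by simp
    qed
    then have "\<psi> (r *\<^sub>R A) \<simeq> r *\<^sub>R \<psi> A" using A mem by (simp add: E_def m_eqv_iff)
    then have "centered (\<psi> (r *\<^sub>R A)) = r *\<^sub>R centered (\<psi> A)"
      by (simp add: centered_cong flip: centered_scaleR)
    moreover have "centered (\<psi> B) = \<psi> B" for B
      unfolding \<psi>_def by (rule centered_cong[OF centered_eqv])
    ultimately show ?thesis by simp
  qed
  have "\<exists>A\<in>Bs. \<psi> A \<simeq> B" if "B \<in> Bs" for B
  proof -
    have "B + \<phi> 0 \<in> \<phi> ` Bs" using bij that \<phi> by (simp add: bij_betw_def)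
    then obtain A where "A \<in> Bs" "\<phi> A = B + \<phi> 0" by force
    then show ?thesis using centered_eqv[of B] by (intro bexI[of _ A]) (simp_all add: \<psi>_def)
  qed
  then show ?thesis by unfold_locales (use mem add scl dev in auto)
qed

end

text \<open>\<open>X\<close> is the value of \<open>\<phi>\<close> at 0, and \<open>f A\<close> is
  the scalar lost in passing to the quotient. The two forms of the conclusion correspond to the two
  signs in \<open>uniform_sign\<close>.\<close>

theorem theorem4:
  fixes \<phi> :: "('a::complex_hilbert_space \<Rightarrow>\<^sub>L 'a) \<Rightarrow> ('a \<Rightarrow>\<^sub>L 'a)"
  assumes "bij_betw \<phi> Bs Bs"
    and "\<And>A B. A \<in> Bs \<Longrightarrow> B \<in> Bs \<Longrightarrow> d_v (\<phi> A) (\<phi> B) = d_v A B"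
  shows "\<exists>U X. \<exists>f :: ('a \<Rightarrow>\<^sub>L 'a) \<Rightarrow> real.
    (unitary_op U \<or> antiunitary_op U) \<and> X \<in> Bs \<and>
    ((\<forall>A\<in>Bs. \<phi> A = (U o\<^sub>L A o\<^sub>L adjoint_op U) + X + f A *\<^sub>R id_blinfun) \<or>
     (\<forall>A\<in>Bs. \<phi> A = - (U o\<^sub>L A o\<^sub>L adjoint_op U) + X + f A *\<^sub>R id_blinfun))"
proof (cases "\<exists>e f :: 'a. norm e = 1 \<and> norm f = 1 \<and> cinner e f = 0")
  case True
  then obtain e0 f0 :: 'a where "norm e0 = 1" "norm f0 = 1" "cinner e0 f0 = 0" by blast
  then interpret nonscalar_space e0 f0 by unfold_locales
  define \<psi> where "\<psi> A = centered (\<phi> A - \<phi> 0)" for A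
  interpret dev_isometry e0 f0 \<psi>
    unfolding \<psi>_def using assms by (intro dev_isometry_centered) (auto simp: d_v_def)
  have \<phi>\<psi>: "\<exists>f. \<forall>A\<in>Bs. \<phi> A = B A + \<phi> 0 + f A *\<^sub>R id_blinfun"
    if B: "\<And>A. A \<in> Bs \<Longrightarrow> centered (\<phi> A - \<phi> 0) \<simeq> B A" for B
  proof -
    have "\<exists>c. \<phi> A = B A + \<phi> 0 + c *\<^sub>R id_blinfun" if A: "A \<in> Bs" for A
    proof -
      have "\<phi> A - \<phi> 0 \<simeq> B A"
        by (rule eqv_trans[OF eqv_sym[OF centered_eqv] B[OF A]])
      then show ?thesis by (auto simp: eq_mod_scalar_def algebra_simps)
    qed
    then show ?thesis by metis
  qed
  have \<phi>0: "\<phi> 0 \<in> Bs" using assms(1) Bs_zero by (rule bij_betw_apply)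
  from uniform_sign show ?thesis
  proof
    assume "\<forall>x. norm x = 1 \<longrightarrow> (\<exists>y. norm y = 1 \<and> \<psi> (rank_one x) \<simeq> rank_one y)"
    then interpret pos_isometry e0 f0 \<psi> by unfold_locales auto
    obtain U where "unitary_op U \<or> antiunitary_op U"
      "\<And>A. A \<in> Bs \<Longrightarrow> \<psi> A \<simeq> U o\<^sub>L A o\<^sub>L adjoint_op U" using classification by blast
    then show ?thesis using \<phi>\<psi>[folded \<psi>_def, of "\<lambda>A. U o\<^sub>L A o\<^sub>L adjoint_op U"] \<phi>0 by blast
  next
    assume "\<forall>x. norm x = 1 \<longrightarrow> (\<exists>y. norm y = 1 \<and> \<psi> (rank_one x) \<simeq> - rank_one y)"
    \<comment> \<open>The negative case is reduced to the positive one by passing to the isometry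
      \<open>- \<psi>\<close>.\<close>
    then have neg: "\<exists>y. norm y = 1 \<and> - \<psi> (rank_one x) \<simeq> rank_one y" if "norm x = 1" for x
      using that eqv_minus by (metis minus_minus)
    have "\<exists>A\<in>Bs. - \<psi> A \<simeq> B" if B: "B \<in> Bs" for B
    proof -
      obtain A where A: "A \<in> Bs" "\<psi> A \<simeq> - B" using surjE[of "- B"] B by auto
      then show ?thesis using eqv_minus[OF A(2)] by auto
    qed
    then interpret N: pos_isometry e0 f0 "\<lambda>A. - \<psi> A"
      by unfold_locales (use neg in \<open>auto simp: add scl m_minus dev\<close>)
    obtain U where U: "unitary_op U \<or> antiunitary_op U"
      "\<And>A. A \<in> Bs \<Longrightarrow> - \<psi> A \<simeq> U o\<^sub>L A o\<^sub>L adjoint_op U" using N.classification by blast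
    have "\<psi> A \<simeq> - (U o\<^sub>L A o\<^sub>L adjoint_op U)" if "A \<in> Bs" for A
      using eqv_minus[OF U(2)[OF that]] by simp
    then show ?thesis using \<phi>\<psi>[folded \<psi>_def, of "\<lambda>A. - (U o\<^sub>L A o\<^sub>L adjoint_op U)"] \<phi>0 U(1) by blast
  qed
next
  case False
  \<comment> \<open>Without an orthonormal pair every self-adjoint operator is scalar, so
    \<open>f\<close> can absorb everything and the identity serves as \<open>U\<close>.\<close>
  then have scalar: "A \<simeq> 0" if "A \<in> Bs" for A :: "'a \<Rightarrow>\<^sub>L 'a" using scalarI[OF that] by blast
  have U: "unitary_op (id_blinfun :: 'a \<Rightarrow>\<^sub>L 'a)"
    by (simp add: unitary_op_def clinear_op_def bij_def)
  have adj: "adjoint_op (id_blinfun :: 'a \<Rightarrow>\<^sub>L 'a) = id_blinfun"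
    using adjoint_op_inverse(1)[of "id_blinfun :: 'a \<Rightarrow>\<^sub>L 'a"] U
    by (intro blinfun_eqI) (metis blinfun_apply_blinfun_compose blinfun_apply_id_blinfun id_apply)
  have "\<exists>c. \<phi> A = (id_blinfun o\<^sub>L A o\<^sub>L adjoint_op id_blinfun) + 0 + c *\<^sub>R id_blinfun" if A: "A \<in> Bs" for A
  proof -
    have "\<phi> A \<in> Bs" using assms(1) A by (rule bij_betw_apply)
    then have "\<phi> A \<simeq> A" using scalar A eqv_trans eqv_sym by blast
    moreover have "(id_blinfun o\<^sub>L A o\<^sub>L adjoint_op id_blinfun) = A"
      by (intro blinfun_eqI) (simp add: adj)
    ultimately show ?thesis by (simp add: eq_mod_scalar_def)
  qed
  then obtain f where "\<forall>A\<in>Bs. \<phi> A = (id_blinfun o\<^sub>L A o\<^sub>L adjoint_op id_blinfun) + 0 + f A *\<^sub>R id_blinfun"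
    by metis
  then show ?thesis using U Bs_zero by blast
qed

end
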